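(* Let $0<\alpha<1$, $\beta>0$, $\mu>0$, let $\mathcal{E}$ be a Gaussian white noise on $\mathbb{R}$ with intensity $\sigma^2$, and let $$X(t)=\frac{1}{\Gamma(\beta)}\int_0^\infty dz\int_0^\infty ds\; s^{\beta-1}e^{-s\mu}\,h_\alpha(z,s)\,\mathcal{E}(t+z).$$ Let $S_1(w)$ and $S_2(w)$, $w\ge 0$, be independent symmetric stable processes with densities $g_1(x,w)$ and $g_2(x,w)$, $x\in\mathbb{R}$, and characteristic functions $$\mathbb{E}e^{i\tau S_1(w)}=e^{-|\tau|^{2\alpha}w},\qquad \mathbb{E}e^{i\tau S_2(w)}=e^{-2\mu\cos\left(\frac{\pi\alpha}{2}\right)|\tau|^{\alpha}w},\qquad \tau\in\mathbb{R}.$$ Then the covariance function of $X$ is $$\mathrm{Cov}_X(h)=\frac{\sigma^2}{\Gamma(\beta)}\int_0^\infty w^{\beta-1}e^{-w\mu^2}\int_{-\infty}^{+\infty}g_1(h-z,w)\,g_2(z,w)\,dz\,dw,$$ or, equivalently, $$\mathrm{Cov}_X(h)=\frac{\sigma^2}{\mu^{2\beta}}\,\mathbb{E}\,g_{S_1+S_2}(h,W_\beta),$$ where $g_{S_1+S_2}(\cdot,w)$ is the density of $S_1(w)+S_2(w)$ and $W_\beta$ is a gamma random variable with shape $\beta$ and rate $\mu^2$, i.e. with density $\frac{\mu^{2\beta}}{\Gamma(\beta)}w^{\beta-1}e^{-\mu^2w}$, $w>0$.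
   Context: Stable subordinator density: $h_\alpha(z,s)$, $z,s\ge 0$, is the probability density in $z$ of the positively skewed stable process (stable subordinator) of order $\alpha\in(0,1)$ at time $s$, i.e. $\int_0^\infty e^{-\xi z}h_\alpha(z,s)\,dz=e^{-s\xi^\alpha}$ for $\xi\ge 0$. White noise: $\mathcal{E}$ is a centered Gaussian linear family $\{\mathcal{E}(\varphi):\varphi\in L^2(\mathbb{R})\}$ with $\mathbb{E}[\mathcal{E}(\varphi)\mathcal{E}(\psi)]=\sigma^2\int_{\mathbb{R}}\varphi\psi\,dt$; formally $\mathcal{E}(\varphi)=\int\varphi(t)\mathcal{E}(t)dt$ and $\mathbb{E}\,\mathcal{E}(t)\mathcal{E}(s)=\sigma^2\delta(t-s)$. For a kernel $K\in L^1(\mathbb{R})$, the expression $X(t)=\int K(x)\mathcal{E}(t+x)\,dx$ denotes the generalized process $X(\varphi)=\mathcal{E}(K*\varphi)$, $\varphi\in L^2(\mathbb{R})$. In an iterated integral such as the one in the claim, $K$ is the function obtained by carrying out the other integration ($K(z)=0$ for $z<0$). Covariance function: $\mathrm{Cov}_X(h)=\mathbb{E}[X(t+h)X(t)]$, where $\mathbb{E}X(t)=0$. For generalized processes this means that $\mathrm{Cov}_X$ is the integrable function on $\mathbb{R}$ with $\mathbb{E}[X(\varphi)X(\psi)]=\int\int\mathrm{Cov}_X(t-s)\varphi(t)\psi(s)\,dt\,ds$ for all $\varphi,\psi\in L^2(\mathbb{R})$; formulas for $\mathrm{Cov}_X$ are identities between such functions (almost everywhere in $h$). *)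

theory Defs
  imports "HOL-Probability.Probability"
begin

text \<open>Membership in \<open>L\<^sup>2(\<real>)\<close>, for Borel representatives.\<close>

definition square_integrable :: "(real \<Rightarrow> real) \<Rightarrow> bool" where
  "square_integrable \<phi> \<longleftrightarrow>
     \<phi> \<in> borel_measurable lborel \<and> integrable lborel (\<lambda>x. (\<phi> x)\<^sup>2)"

text \<open>Constant random variables count as (degenerate) Gaussian ones.\<close>

definition gaussian_rv :: "'a measure \<Rightarrow> ('a \<Rightarrow> real) \<Rightarrow> bool" where
  "gaussian_rv M Y \<longleftrightarrow> Y \<in> borel_measurable M \<and>
     ((\<exists>m. AE \<omega> in M. Y \<omega> = m) \<or>
      (\<exists>m s. s > 0 \<and> distributed M lborel Y (\<lambda>x. ennreal (normal_density m s x))))"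

text \<open>Gaussian white noise of intensity \<open>v\<close>: a centered, jointly Gaussian family indexed by
  \<open>L\<^sup>2(\<real>)\<close>, linear almost surely.  That \<open>\<E> \<phi>\<close> depends (up to a null set) only on the
  almost-everywhere class of \<open>\<phi>\<close> follows from linearity and the covariance identity.\<close>

definition gaussian_white_noise ::
    "'a measure \<Rightarrow> real \<Rightarrow> ((real \<Rightarrow> real) \<Rightarrow> 'a \<Rightarrow> real) \<Rightarrow> bool" where
  "gaussian_white_noise M v \<E> \<longleftrightarrow>
     prob_space M \<and>
     (\<forall>F c. finite F \<and> (\<forall>\<phi>\<in>F. square_integrable \<phi>) \<longrightarrow>
        gaussian_rv M (\<lambda>\<omega>. \<Sum>\<phi>\<in>F. c \<phi> * \<E> \<phi> \<omega>)) \<and>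
     (\<forall>\<phi>. square_integrable \<phi> \<longrightarrow> (\<integral>\<omega>. \<E> \<phi> \<omega> \<partial>M) = 0) \<and>
     (\<forall>a b \<phi> \<psi>. square_integrable \<phi> \<and> square_integrable \<psi> \<longrightarrow>
        (AE \<omega> in M. \<E> (\<lambda>x. a * \<phi> x + b * \<psi> x) \<omega> = a * \<E> \<phi> \<omega> + b * \<E> \<psi> \<omega>)) \<and>
     (\<forall>\<phi> \<psi>. square_integrable \<phi> \<and> square_integrable \<psi> \<longrightarrow>
        (\<integral>\<omega>. \<E> \<phi> \<omega> * \<E> \<psi> \<omega> \<partial>M) = v * (LBINT t. \<phi> t * \<psi> t))"

definition fun_convolution :: "(real \<Rightarrow> real) \<Rightarrow> (real \<Rightarrow> real) \<Rightarrow> real \<Rightarrow> real" where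
  "fun_convolution K \<phi> = (\<lambda>x. LBINT y. K y * \<phi> (x - y))"

text \<open>The generalized process \<open>X(t) = \<integral> K(x) \<E>(t + x) dx\<close>: testing against \<open>\<phi>\<close> and
  substituting \<open>y = t + x\<close> gives \<open>X(\<phi>) = \<E>(K * \<phi>)\<close>.\<close>

definition filtered_noise ::
    "((real \<Rightarrow> real) \<Rightarrow> 'a \<Rightarrow> real) \<Rightarrow> (real \<Rightarrow> real) \<Rightarrow> (real \<Rightarrow> real) \<Rightarrow> 'a \<Rightarrow> real" where
  "filtered_noise \<E> K = (\<lambda>\<phi>. \<E> (fun_convolution K \<phi>))"

text \<open>\<open>C\<close> is (a representative of) the covariance function of the centered generalized
  process \<open>X\<close>.\<close>

definition is_covariance_function ::
    "'a measure \<Rightarrow> ((real \<Rightarrow> real) \<Rightarrow> 'a \<Rightarrow> real) \<Rightarrow> (real \<Rightarrow> real) \<Rightarrow> bool" where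
  "is_covariance_function M X C \<longleftrightarrow>
     integrable lborel C \<and>
     (\<forall>\<phi> \<psi>. square_integrable \<phi> \<and> square_integrable \<psi> \<longrightarrow>
        (\<integral>\<omega>. X \<phi> \<omega> * X \<psi> \<omega> \<partial>M) = (LBINT s. LBINT t. C (t - s) * \<phi> t * \<psi> s))"

text \<open>\<open>h z s\<close> is the density at \<open>z \<ge> 0\<close> of the stable subordinator of order \<open>\<alpha>\<close> at time \<open>s\<close>,
  characterised by its Laplace transform; the case \<open>\<xi> = 0\<close> says that the total mass is \<open>1\<close>.
  Time \<open>0\<close> is excluded, as the law is then a point mass.  Joint measurability restricts the
  choice of versions so that integrating in \<open>s\<close> is meaningful.\<close>

definition stable_subordinator_density :: "real \<Rightarrow> (real \<Rightarrow> real \<Rightarrow> real) \<Rightarrow> bool" where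
  "stable_subordinator_density \<alpha> h \<longleftrightarrow>
     set_borel_measurable borel ({0..} \<times> {0<..}) (\<lambda>(z, s). h z s) \<and>
     (\<forall>z\<ge>0. \<forall>s>0. 0 \<le> h z s) \<and>
     (\<forall>s>0. \<forall>\<xi>\<ge>0. (LBINT z:{0..}. exp (- \<xi> * z) * h z s) = exp (- s * \<xi> powr \<alpha>))"

text \<open>Levy processes in law: no path regularity is imposed.\<close>

definition levy_process :: "'a measure \<Rightarrow> (real \<Rightarrow> 'a \<Rightarrow> real) \<Rightarrow> bool" where
  "levy_process N S \<longleftrightarrow>
     prob_space N \<and>
     (\<forall>w\<ge>0. S w \<in> borel_measurable N) \<and>
     (AE \<omega> in N. S 0 \<omega> = 0) \<and>
     (\<forall>(n::nat) t. 0 \<le> t 0 \<and> (\<forall>i<n. t i \<le> t (Suc i)) \<longrightarrow>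
        prob_space.indep_vars N (\<lambda>_. borel) (\<lambda>i \<omega>. S (t (Suc i)) \<omega> - S (t i) \<omega>) {..<n}) \<and>
     (\<forall>u\<ge>0. \<forall>w\<ge>0. distr N borel (\<lambda>\<omega>. S (u + w) \<omega> - S u \<omega>) = distr N borel (S w)) \<and>
     (\<forall>u\<ge>0. \<forall>\<epsilon>>0. ((\<lambda>w. measure N {\<omega> \<in> space N. \<epsilon> < \<bar>S w \<omega> - S u \<omega>\<bar>}) \<longlongrightarrow> 0)
        (at u within {0..}))"

definition independent_processes ::
    "'a measure \<Rightarrow> (real \<Rightarrow> 'a \<Rightarrow> real) \<Rightarrow> (real \<Rightarrow> 'a \<Rightarrow> real) \<Rightarrow> bool" where
  "independent_processes N S T \<longleftrightarrow>
     prob_space.indep_var N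
       (PiM {0..} (\<lambda>_. borel)) (\<lambda>\<omega>. \<lambda>w\<in>{0..}. S w \<omega>)
       (PiM {0..} (\<lambda>_. borel)) (\<lambda>\<omega>. \<lambda>w\<in>{0..}. T w \<omega>)"

text \<open>\<open>g x w\<close> is the density at \<open>x\<close> of \<open>S w\<close>, for \<open>w > 0\<close>, in a jointly measurable version.
  Values at \<open>w \<le> 0\<close> are arbitrary but measurable, so that \<open>g x (W \<omega>)\<close> is measurable for a random
  time \<open>W\<close> that is positive only almost surely.\<close>

definition has_densities ::
    "'a measure \<Rightarrow> (real \<Rightarrow> 'a \<Rightarrow> real) \<Rightarrow> (real \<Rightarrow> real \<Rightarrow> real) \<Rightarrow> bool" where
  "has_densities N S g \<longleftrightarrow>
     (\<lambda>(x, w). g x w) \<in> borel_measurable borel \<and>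
     (\<forall>x. \<forall>w>0. 0 \<le> g x w) \<and>
     (\<forall>w>0. distributed N lborel (S w) (\<lambda>x. ennreal (g x w)))"

definition gamma_density :: "real \<Rightarrow> real \<Rightarrow> real \<Rightarrow> real" where
  "gamma_density shape rate w =
     (if w > 0 then rate powr shape / Gamma shape * w powr (shape - 1) * exp (- rate * w) else 0)"

end

theory Submission
  imports Defs "HOL-Complex_Analysis.Conformal_Mappings"
begin

text \<open>The noise is white, so \<open>E[X(\<phi>) X(\<psi>)] = \<sigma>\<^sup>2 \<integral> (K * \<phi>) (K * \<psi>)\<close>, and Fubini turns this into
\<open>\<integral>\<integral> C(t - s) \<phi>(t) \<psi>(s) dt ds\<close> with \<open>C = \<sigma>\<^sup>2 R\<close>, where \<open>R(h) = \<integral> K(x) K(x + h) dx\<close> is the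
autocorrelation of the filter (\<open>is_covariance_function_filtered_noise\<close>).  The right-hand side
determines \<open>C\<close> almost everywhere (\<open>translation_kernel_unique\<close>), so the task is to identify \<open>R\<close>.

This is done by Fourier transforms.  The transform of \<open>R\<close> is \<open>\<bar>K^(\<tau>)\<bar>\<^sup>2\<close>.  Integrating the Laplace
transform of the stable subordinator against the gamma kernel gives, for real \<open>\<xi> \<ge> 0\<close>,
\<open>\<integral> e^(- \<xi> z) K(z) dz = (\<mu> + \<xi>^\<alpha>)^(- \<beta>)\<close>.  Both sides are holomorphic in the right half-plane, so the
identity extends to it, and by continuity to the imaginary axis, where it says that
\<open>K^(\<tau>) = (\<mu> + (- i \<tau>)^\<alpha>)^(- \<beta>)\<close>
(\<open>laplace_transform_eq_on_boundary\<close>).  Since \<open>(- i \<tau>)^\<alpha>\<close> has modulus \<open>\<bar>\<tau>\<bar>^\<alpha>\<close> and argument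
\<open>\<plusminus> \<pi> \<alpha> / 2\<close>,
\<open>\<bar>K^(\<tau>)\<bar>\<^sup>2 = (\<mu>\<^sup>2 + \<theta>(\<tau>))^(- \<beta>)\<close> with
\<open>\<theta>(\<tau>) = \<bar>\<tau>\<bar>^(2\<alpha>) + 2 \<mu> cos(\<pi>\<alpha>/2) \<bar>\<tau>\<bar>^\<alpha>\<close>.

On the other hand \<open>e^(- w \<theta>(\<tau>))\<close> is the characteristic function of \<open>S1(w) + S2(w)\<close>, by independence.
Averaging over \<open>w\<close> with the gamma kernel of rate \<open>\<mu>\<^sup>2\<close> gives \<open>(\<mu>\<^sup>2 + \<theta>(\<tau>))^(- \<beta>)\<close> again.  So \<open>R\<close> and
the gamma mixture of the densities of \<open>S1(w) + S2(w)\<close> are nonnegative functions with the same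
Fourier transform and hence agree almost everywhere (\<open>fourier_unique_nonneg\<close>).

The filter \<open>K\<close> is a gamma mixture of subordinator densities and the covariance is a gamma mixture
of densities of \<open>S1(w) + S2(w)\<close>; the locale \<open>gamma_mixture\<close> serves both.\<close>

section \<open>Laplace transforms up to the imaginary axis\<close>

lemma laplace_transform_integrable:
  fixes K :: "real \<Rightarrow> real"
  assumes K: "integrable lborel K" and neg: "\<And>z. z < 0 \<Longrightarrow> K z = 0" and "0 \<le> Re \<zeta>"
  shows "integrable lborel (\<lambda>z. exp (- \<zeta> * of_real z) * of_real (K z))"
proof (rule Bochner_Integration.integrable_bound[OF K])
  have [measurable]: "K \<in> borel_measurable borel" using K by auto
  show "(\<lambda>z. exp (- \<zeta> * of_real z) * of_real (K z)) \<in> borel_measurable lborel" by measurable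
  show "AE z in lborel. norm (exp (- \<zeta> * of_real z) * of_real (K z)) \<le> norm (K z)"
  proof (rule AE_I2)
    fix z
    show "norm (exp (- \<zeta> * of_real z) * of_real (K z)) \<le> norm (K z)"
      using assms(2)[of z] assms(3)
      by (cases "z < 0") (auto simp: norm_mult mult_left_le_one_le)
  qed
qed

text \<open>The constant does not depend on \<open>z\<close>, because \<open>z e^(- \<delta> z) \<le> 1 / \<delta>\<close>.  Hence a
multiple of \<open>\<bar>K\<bar>\<close> dominates the difference quotients of the Laplace transform of \<open>K\<close>.\<close>

lemma exp_times_real_lipschitz:
  fixes u v :: complex and z \<delta> :: real
  assumes "0 \<le> z" "0 < \<delta>" "\<delta> \<le> Re u" "\<delta> \<le> Re v"
  shows "norm (exp (- u * of_real z) - exp (- v * of_real z)) \<le> 1 / \<delta> * norm (u - v)"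
proof (rule field_differentiable_bound[where S = "{w. \<delta> \<le> Re w}"])
  show "convex {w. \<delta> \<le> Re w}" by (rule convex_halfspace_Re_ge)
  fix w assume w: "w \<in> {w. \<delta> \<le> Re w}"
  show "((\<lambda>w. exp (- w * of_real z)) has_field_derivative - of_real z * exp (- w * of_real z))
      (at w within {w. \<delta> \<le> Re w})"
    by (auto intro!: derivative_eq_intros)
  have "z * \<delta> \<le> exp (z * \<delta>)"
    using exp_ge_add_one_self[of "z * \<delta>"] by linarith
  then have "z * exp (- (\<delta> * z)) \<le> 1 / \<delta>"
    using \<open>0 < \<delta>\<close> by (simp add: exp_minus field_simps)
  moreover have "z * exp (- (Re w * z)) \<le> z * exp (- (\<delta> * z))"
    using w assms by (auto intro!: mult_left_mono mult_right_mono)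
  ultimately show "norm (- of_real z * exp (- w * of_real z)) \<le> 1 / \<delta>"
    using assms by (simp add: norm_mult)
qed (use assms in auto)

text \<open>Differentiation under the integral: near \<open>\<zeta>\<close> all difference quotients of the integrand are bounded
by \<open>\<bar>K z\<bar> / \<delta>\<close> with \<open>\<delta> = Re \<zeta> / 2\<close>, so dominated convergence applies.\<close>

lemma laplace_transform_holomorphic:
  fixes K :: "real \<Rightarrow> real"
  assumes K: "integrable lborel K" and neg: "\<And>z. z < 0 \<Longrightarrow> K z = 0"
  shows "(\<lambda>\<zeta>. LINT z|lborel. exp (- \<zeta> * of_real z) * of_real (K z))
           holomorphic_on {\<zeta>. 0 < Re \<zeta>}" (is "?L holomorphic_on _")
proof (rule holomorphic_onI)
  fix \<zeta> assume "\<zeta> \<in> {\<zeta>. 0 < Re \<zeta>}"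
  define \<delta> where "\<delta> = Re \<zeta> / 2"
  have \<delta>: "0 < \<delta>" "Re \<zeta> = 2 * \<delta>" using \<open>\<zeta> \<in> _\<close> by (auto simp: \<delta>_def)
  have [measurable]: "K \<in> borel_measurable borel" using K by auto
  let ?D = "LINT z|lborel. - of_real z * exp (- \<zeta> * of_real z) * of_real (K z)"
  have "((\<lambda>h. (?L (\<zeta> + h) - ?L \<zeta>) / h) \<longlongrightarrow> ?D) (at 0)"
    unfolding tendsto_at_iff_sequentially comp_def
  proof (intro allI impI)
    fix X :: "nat \<Rightarrow> complex"
    assume X0: "\<forall>i. X i \<in> UNIV - {0}" and X: "X \<longlonglongrightarrow> 0"
    \<comment> \<open>The bound needs \<open>\<zeta> + X n\<close> to stay in the half-plane \<open>Re \<ge> \<delta>\<close>, so a finite initial segment is dropped.\<close>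
    obtain N where N: "\<And>n. n \<ge> N \<Longrightarrow> norm (X n) < \<delta>"
      using LIMSEQ_D[OF X \<delta>(1)] by auto
    have X0': "X n \<noteq> 0" for n using X0 by auto
    define Y where "Y n = X (n + N)" for n
    have Y: "Y \<longlonglongrightarrow> 0" "\<And>n. Y n \<noteq> 0" "\<And>n. norm (Y n) < \<delta>"
      using LIMSEQ_ignore_initial_segment[OF X, of N] X0' N unfolding Y_def by auto
    have Re: "\<delta> \<le> Re (\<zeta> + Y n)" for n
      using abs_Re_le_cmod[of "Y n"] Y(3)[of n] \<delta> by simp
    have "(\<lambda>n. (?L (\<zeta> + Y n) - ?L \<zeta>) / Y n) \<longlonglongrightarrow> ?D"
    proof -
      have "(?L (\<zeta> + Y n) - ?L \<zeta>) / Y n = (LINT z|lborel.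
          (exp (- (\<zeta> + Y n) * of_real z) - exp (- \<zeta> * of_real z)) / Y n * of_real (K z))" for n
      proof -
        have "?L (\<zeta> + Y n) - ?L \<zeta> = (LINT z|lborel.
            exp (- (\<zeta> + Y n) * of_real z) * of_real (K z) - exp (- \<zeta> * of_real z) * of_real (K z))"
          using Re[of n] \<delta>
          by (intro Bochner_Integration.integral_diff[symmetric] laplace_transform_integrable[OF K neg]) auto
        then show ?thesis by (simp add: field_simps)
      qed
      moreover have "(\<lambda>n. LINT z|lborel.
          (exp (- (\<zeta> + Y n) * of_real z) - exp (- \<zeta> * of_real z)) / Y n * of_real (K z)) \<longlonglongrightarrow> ?D"
      proof (rule integral_dominated_convergence[where w = "\<lambda>z. 1 / \<delta> * \<bar>K z\<bar>"])
        show "integrable lborel (\<lambda>z. 1 / \<delta> * \<bar>K z\<bar>)" using K by auto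
        show "AE z in lborel. (\<lambda>n. (exp (- (\<zeta> + Y n) * of_real z) - exp (- \<zeta> * of_real z)) / Y n
              * of_real (K z)) \<longlonglongrightarrow> - of_real z * exp (- \<zeta> * of_real z) * of_real (K z)"
        proof (rule AE_I2)
          fix z
          have "((\<lambda>w. exp (- w * of_real z)) has_field_derivative
              - of_real z * exp (- \<zeta> * of_real z)) (at \<zeta>)"
            by (auto intro!: derivative_eq_intros)
          then have "((\<lambda>h. (exp (- (\<zeta> + h) * of_real z) - exp (- \<zeta> * of_real z)) / h)
              \<longlongrightarrow> - of_real z * exp (- \<zeta> * of_real z)) (at 0)"
            unfolding DERIV_def .
          then have "(\<lambda>n. (exp (- (\<zeta> + Y n) * of_real z) - exp (- \<zeta> * of_real z)) / Y n)
              \<longlonglongrightarrow> - of_real z * exp (- \<zeta> * of_real z)"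
            using Y unfolding tendsto_at_iff_sequentially comp_def by blast
          then show "(\<lambda>n. (exp (- (\<zeta> + Y n) * of_real z) - exp (- \<zeta> * of_real z)) / Y n
              * of_real (K z)) \<longlonglongrightarrow> - of_real z * exp (- \<zeta> * of_real z) * of_real (K z)"
            by (rule tendsto_mult_right)
        qed
        show "AE z in lborel. norm ((exp (- (\<zeta> + Y n) * of_real z) - exp (- \<zeta> * of_real z)) / Y n
              * of_real (K z)) \<le> 1 / \<delta> * \<bar>K z\<bar>" for n
        proof (rule AE_I2)
          fix z
          show "norm ((exp (- (\<zeta> + Y n) * of_real z) - exp (- \<zeta> * of_real z)) / Y n
              * of_real (K z)) \<le> 1 / \<delta> * \<bar>K z\<bar>"
          proof (cases "z < 0")
            case False
            have "norm (exp (- (\<zeta> + Y n) * of_real z) - exp (- \<zeta> * of_real z)) \<le> 1 / \<delta> * norm (Y n)"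
              using exp_times_real_lipschitz[of z \<delta> "\<zeta> + Y n" \<zeta>] False \<delta> Re[of n] by simp
            then have "norm ((exp (- (\<zeta> + Y n) * of_real z) - exp (- \<zeta> * of_real z)) / Y n) \<le> 1 / \<delta>"
              using Y(2)[of n] by (simp add: norm_divide divide_le_eq)
            then have "norm ((exp (- (\<zeta> + Y n) * of_real z) - exp (- \<zeta> * of_real z)) / Y n) * \<bar>K z\<bar>
                \<le> 1 / \<delta> * \<bar>K z\<bar>"
              by (rule mult_right_mono) simp
            then show ?thesis by (simp only: norm_mult norm_of_real)
          qed (simp add: neg)
        qed
      qed measurable
      ultimately show ?thesis by (simp only:)
    qed
    then show "(\<lambda>n. (?L (\<zeta> + X n) - ?L \<zeta>) / X n) \<longlonglongrightarrow> ?D"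
      unfolding Y_def by (rule LIMSEQ_offset)
  qed
  then have "(?L has_field_derivative ?D) (at \<zeta>)" unfolding DERIV_def .
  then show "?L field_differentiable at \<zeta> within {\<zeta>. 0 < Re \<zeta>}"
    unfolding field_differentiable_def using has_field_derivative_at_within by blast
qed

lemma laplace_transform_eq_on_halfplane:
  fixes K :: "real \<Rightarrow> real"
  assumes K: "integrable lborel K" and neg: "\<And>z. z < 0 \<Longrightarrow> K z = 0"
    and f: "f holomorphic_on {\<zeta>. 0 < Re \<zeta>}"
    and eq: "\<And>\<xi>. 0 < \<xi> \<Longrightarrow> (LINT z|lborel. exp (- of_real \<xi> * of_real z) * of_real (K z)) = f (of_real \<xi>)"
    and \<zeta>: "0 < Re \<zeta>"
  shows "(LINT z|lborel. exp (- \<zeta> * of_real z) * of_real (K z)) = f \<zeta>" (is "?L \<zeta> = _")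
proof -
  let ?S = "{\<zeta>. 0 < Re \<zeta>}"
  have lim: "(1::complex) islimpt (of_real ` {0<..})"
    unfolding islimpt_sequential
  proof (intro exI conjI allI)
    fix n :: nat
    show "complex_of_real (1 + 1 / real (Suc n)) \<in> of_real ` {0<..} - {1}"
      by (auto simp: add_pos_pos simp del: of_real_add of_real_divide)
    have "(\<lambda>n. complex_of_real (1 + 1 / real (Suc n))) \<longlonglongrightarrow> of_real (1 + 0)"
      by (intro tendsto_intros LIMSEQ_Suc lim_1_over_n)
    then show "(\<lambda>n. complex_of_real (1 + 1 / real (Suc n))) \<longlonglongrightarrow> 1" by simp
  qed
  have "?L \<zeta> - f \<zeta> = 0"
  proof (rule analytic_continuation[of "\<lambda>\<zeta>. ?L \<zeta> - f \<zeta>" ?S "of_real ` {0<..}" 1])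
    show "(\<lambda>\<zeta>. ?L \<zeta> - f \<zeta>) holomorphic_on ?S"
      by (intro holomorphic_on_diff laplace_transform_holomorphic[OF K neg] f)
    show "open ?S" by (rule open_halfspace_Re_gt)
    show "connected ?S" by (intro convex_connected convex_halfspace_Re_gt)
  qed (use \<zeta> lim eq in auto)
  then show ?thesis by simp
qed

text \<open>Transforms of integrable functions are continuous up to the imaginary axis, so an identity on the
positive reals, once continued to the open half-plane, passes to the limit along horizontal lines.
The transform is thus known on the imaginary axis, where it is the Fourier transform.\<close>

lemma laplace_transform_eq_on_boundary:
  fixes K :: "real \<Rightarrow> real"
  assumes K: "integrable lborel K" and neg: "\<And>z. z < 0 \<Longrightarrow> K z = 0"
    and f: "f holomorphic_on {\<zeta>. 0 < Re \<zeta>}"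
    and eq: "\<And>\<xi>. 0 < \<xi> \<Longrightarrow> (LINT z|lborel. exp (- of_real \<xi> * of_real z) * of_real (K z)) = f (of_real \<xi>)"
    and \<zeta>: "Re \<zeta> = 0" and cont: "isCont f \<zeta>"
  shows "(LINT z|lborel. exp (- \<zeta> * of_real z) * of_real (K z)) = f \<zeta>" (is "?L \<zeta> = _")
proof -
  have [measurable]: "K \<in> borel_measurable borel" using K by auto
  define Z where "Z n = \<zeta> + of_real (1 / real (Suc n))" for n
  have ReZ: "0 < Re (Z n)" for n by (simp add: Z_def \<zeta>)
  have "Z \<longlonglongrightarrow> \<zeta> + of_real 0"
    unfolding Z_def by (intro tendsto_intros LIMSEQ_Suc lim_1_over_n)
  then have Z: "Z \<longlonglongrightarrow> \<zeta>" by simp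
  have "(\<lambda>n. ?L (Z n)) \<longlonglongrightarrow> ?L \<zeta>"
  proof (rule integral_dominated_convergence[where w = "\<lambda>z. \<bar>K z\<bar>"])
    show "integrable lborel (\<lambda>z. \<bar>K z\<bar>)" using K by auto
    show "AE z in lborel. (\<lambda>n. exp (- Z n * of_real z) * of_real (K z)) \<longlonglongrightarrow> exp (- \<zeta> * of_real z) * of_real (K z)"
      by (intro AE_I2 tendsto_intros Z)
    show "AE z in lborel. norm (exp (- Z n * of_real z) * of_real (K z)) \<le> \<bar>K z\<bar>" for n
    proof (rule AE_I2)
      fix z
      show "norm (exp (- Z n * of_real z) * of_real (K z)) \<le> \<bar>K z\<bar>"
        using neg[of z] ReZ[of n] by (cases "z < 0") (auto simp: norm_mult mult_left_le_one_le)
    qed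
  qed measurable
  moreover have "?L (Z n) = f (Z n)" for n
    by (rule laplace_transform_eq_on_halfplane[OF K neg f eq ReZ])
  moreover have "(\<lambda>n. f (Z n)) \<longlonglongrightarrow> f \<zeta>"
    by (rule isCont_tendsto_compose[OF cont Z])
  ultimately show ?thesis by (simp add: LIMSEQ_unique)
qed

section \<open>Powers in the closed right half-plane\<close>

text \<open>For \<open>\<alpha> < 1\<close> the power shrinks the argument, which keeps \<open>\<mu> + \<zeta>^\<alpha>\<close> away from the branch cut of the
outer power in \<open>(\<mu> + \<zeta>^\<alpha>)^(- \<beta>)\<close>.\<close>

lemma Re_powr_pos:
  assumes "0 \<le> Re \<zeta>" "\<zeta> \<noteq> 0" "0 < \<alpha>" "\<alpha> < 1"
  shows "0 < Re (\<zeta> powr complex_of_real \<alpha>)"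
proof -
  have "\<bar>Im (Ln \<zeta>)\<bar> \<le> pi / 2" using Re_Ln_pos_le assms by blast
  with \<open>0 < \<alpha>\<close> have "\<alpha> * \<bar>Im (Ln \<zeta>)\<bar> \<le> \<alpha> * (pi / 2)"
    by (intro mult_left_mono) auto
  also have "\<dots> < pi / 2" using \<open>\<alpha> < 1\<close> by simp
  finally have "\<bar>\<alpha> * Im (Ln \<zeta>)\<bar> < pi / 2" using \<open>0 < \<alpha>\<close> by (simp add: abs_mult)
  then have "0 < cos (\<alpha> * Im (Ln \<zeta>))" by (intro cos_gt_zero_pi) auto
  then show ?thesis using assms by (simp add: powr_def Re_exp)
qed

text \<open>Law of cosines: \<open>(i \<tau>)^\<alpha>\<close> has modulus \<open>\<bar>\<tau>\<bar>^\<alpha>\<close> and argument \<open>sgn \<tau> \<cdot> \<pi> \<alpha> / 2\<close>.  This is where the two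
stable exponents \<open>2 \<alpha>\<close> and \<open>\<alpha>\<close> come from.\<close>

lemma norm_add_imaginary_powr:
  assumes "\<tau> \<noteq> 0"
  shows "(norm (of_real \<mu> + (\<i> * of_real \<tau>) powr complex_of_real \<alpha>))\<^sup>2 =
    \<mu>\<^sup>2 + (\<bar>\<tau>\<bar> powr (2 * \<alpha>) + 2 * \<mu> * cos (pi * \<alpha> / 2) * \<bar>\<tau>\<bar> powr \<alpha>)"
proof -
  define \<theta> where "\<theta> = sgn \<tau> * (pi / 2)"
  have \<theta>: "Ln (\<i> * of_real \<tau>) = of_real (ln \<bar>\<tau>\<bar>) + \<i> * of_real \<theta>"
  proof (rule Ln_unique)
    have "exp (of_real (ln \<bar>\<tau>\<bar>) + \<i> * of_real \<theta>) = of_real \<bar>\<tau>\<bar> * (cis \<theta>)"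
      using assms by (simp add: exp_add cis_conv_exp exp_of_real)
    also have "cis \<theta> = \<i> * of_real (sgn \<tau>)"
      using assms by (auto simp: \<theta>_def sgn_if complex_eq_iff)
    finally show "exp (of_real (ln \<bar>\<tau>\<bar>) + \<i> * of_real \<theta>) = \<i> * of_real \<tau>"
      by (simp add: mult.left_commute abs_mult_sgn flip: of_real_mult)
  qed (auto simp: \<theta>_def sgn_if)
  have c: "cos (\<alpha> * \<theta>) = cos (pi * \<alpha> / 2)"
    using assms by (auto simp: \<theta>_def sgn_if mult.commute)
  let ?r = "\<bar>\<tau>\<bar> powr \<alpha>"
  have "(\<i> * of_real \<tau>) powr complex_of_real \<alpha> = exp (of_real (\<alpha> * ln \<bar>\<tau>\<bar>)) * cis (\<alpha> * \<theta>)"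
    using assms \<theta> by (simp add: powr_def algebra_simps exp_add cis_conv_exp)
  also have "exp (complex_of_real (\<alpha> * ln \<bar>\<tau>\<bar>)) = of_real ?r"
    using assms by (simp add: powr_def exp_of_real del: of_real_mult)
  finally have "(norm (of_real \<mu> + (\<i> * of_real \<tau>) powr complex_of_real \<alpha>))\<^sup>2
      = (\<mu> + ?r * cos (\<alpha> * \<theta>))\<^sup>2 + (?r * sin (\<alpha> * \<theta>))\<^sup>2"
    by (simp add: cmod_power2)
  also have "\<dots> = \<mu>\<^sup>2 + 2 * \<mu> * ?r * cos (\<alpha> * \<theta>) + ?r\<^sup>2 * ((cos (\<alpha> * \<theta>))\<^sup>2 + (sin (\<alpha> * \<theta>))\<^sup>2)"
    by (simp only: power2_sum power_mult_distrib distrib_left)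
  also have "\<dots> = \<mu>\<^sup>2 + 2 * \<mu> * ?r * cos (pi * \<alpha> / 2) + ?r\<^sup>2" by (simp flip: c)
  also have "?r\<^sup>2 = \<bar>\<tau>\<bar> powr (2 * \<alpha>)" by (simp only: power2_eq_square mult_2 powr_add)
  finally show ?thesis by simp
qed


section \<open>Uniqueness of Fourier transforms\<close>

text \<open>Dividing by the common mass makes both functions probability densities, and Levy's uniqueness
theorem for characteristic functions applies.\<close>

lemma fourier_unique_nonneg:
  fixes f g :: "real \<Rightarrow> real"
  assumes f: "integrable lborel f" "\<And>x. 0 \<le> f x" and g: "integrable lborel g" "\<And>x. 0 \<le> g x"
    and eq: "\<And>\<tau>. (LINT x|lborel. iexp (\<tau> * x) * of_real (f x)) = (LINT x|lborel. iexp (\<tau> * x) * of_real (g x))"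
    and mass: "0 < (LBINT x. f x)"
  shows "AE x in lborel. f x = g x"
proof -
  define m where "m = (LBINT x. f x)"
  have m: "0 < m" using mass by (simp add: m_def)
  have [measurable]: "f \<in> borel_measurable borel" "g \<in> borel_measurable borel" using f g by auto
  have mg: "m = (LBINT x. g x)" using eq[of 0] by (simp add: m_def)
  define P where "P u = density lborel (\<lambda>x. ennreal (u x / m))" for u :: "real \<Rightarrow> real"
  have real: "real_distribution (P u)"
    if "integrable lborel u" "\<And>x. 0 \<le> u x" "m = (LBINT x. u x)" for u
  proof -
    have [measurable]: "u \<in> borel_measurable borel" using that by auto
    have "(\<integral>\<^sup>+x. ennreal (u x / m) \<partial>lborel) = ennreal (LBINT x. u x / m)"
      using that m by (intro nn_integral_eq_integral) auto
    also have "\<dots> = 1" using m that(3) by simp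
    finally have "prob_space (P u)"
      by (intro prob_spaceI) (simp add: P_def emeasure_density cong: nn_integral_cong)
    then show ?thesis
      by (simp add: real_distribution_def real_distribution_axioms_def P_def)
  qed
  have char: "char (P u) \<tau> = (LINT x|lborel. iexp (\<tau> * x) * of_real (u x)) / of_real m"
    if [measurable]: "u \<in> borel_measurable borel" and "\<And>x. 0 \<le> u x" for u \<tau>
  proof -
    have "char (P u) \<tau> = (LINT x|lborel. (u x / m) *\<^sub>R iexp (\<tau> * x))"
      unfolding char_def P_def using that m by (intro integral_density) auto
    also have "\<dots> = (LINT x|lborel. (iexp (\<tau> * x) * of_real (u x)) / of_real m)"
      by (intro Bochner_Integration.integral_cong) (auto simp: scaleR_conv_of_real)
    finally show ?thesis by simp
  qed
  have "char (P f) = char (P g)"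
    by (rule ext) (simp only: char[OF \<open>f \<in> _\<close> f(2)] char[OF \<open>g \<in> _\<close> g(2)] eq)
  then have "P f = P g"
    by (intro Levy_uniqueness real f g m_def mg) auto
  moreover have "(\<integral>\<^sup>+x. ennreal (f x / m) \<partial>lborel) \<noteq> \<infinity>"
    using f m by (subst nn_integral_eq_integral) auto
  ultimately have "AE x in lborel. ennreal (f x / m) = ennreal (g x / m)"
    unfolding P_def by (subst (asm) finite_density_unique) auto
  then show ?thesis
    by eventually_elim (use f g m in \<open>simp add: ennreal_inj\<close>)
qed


section \<open>Gamma mixtures\<close>

lemma nn_integral_gamma_kernel:
  fixes \<beta> \<rho> :: real
  assumes "0 < \<beta>" "0 < \<rho>"
  shows "(\<integral>\<^sup>+w. ennreal (indicator {0<..} w * (w powr (\<beta> - 1) * exp (- w * \<rho>))) \<partial>lborel)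
    = ennreal (Gamma \<beta> * \<rho> powr - \<beta>)" (is "?I = _")
proof -
  have "ennreal (Gamma \<beta>) = (\<integral>\<^sup>+t. ennreal (indicator {0..} t * t powr (\<beta> - 1) / exp t) \<partial>lborel)"
    by (rule Gamma_conv_nn_integral_real[OF \<open>0 < \<beta>\<close>])
  also have "\<dots> = ennreal \<bar>\<rho>\<bar> * (\<integral>\<^sup>+w. ennreal (indicator {0..} (0 + \<rho> * w) * (0 + \<rho> * w) powr (\<beta> - 1) / exp (0 + \<rho> * w)) \<partial>lborel)"
    using assms by (intro nn_integral_real_affine) auto
  also have "(\<lambda>w. ennreal (indicator {0..} (0 + \<rho> * w) * (0 + \<rho> * w) powr (\<beta> - 1) / exp (0 + \<rho> * w)))
      = (\<lambda>w. ennreal (\<rho> powr (\<beta> - 1)) * ennreal (indicator {0<..} w * (w powr (\<beta> - 1) * exp (- w * \<rho>))))"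
  proof
    fix w
    have "indicator {0..} (0 + \<rho> * w) * (0 + \<rho> * w) powr (\<beta> - 1) / exp (0 + \<rho> * w)
        = \<rho> powr (\<beta> - 1) * (indicator {0<..} w * (w powr (\<beta> - 1) * exp (- w * \<rho>)))"
      using assms
      by (auto simp: indicator_def powr_mult exp_minus field_simps zero_le_mult_iff)
    then show "ennreal (indicator {0..} (0 + \<rho> * w) * (0 + \<rho> * w) powr (\<beta> - 1) / exp (0 + \<rho> * w))
        = ennreal (\<rho> powr (\<beta> - 1)) * ennreal (indicator {0<..} w * (w powr (\<beta> - 1) * exp (- w * \<rho>)))"
      by (simp add: ennreal_mult')
  qed
  also have "(\<integral>\<^sup>+w. \<dots> w \<partial>lborel) = ennreal (\<rho> powr (\<beta> - 1)) * ?I"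
    by (intro nn_integral_cmult) auto
  also have "ennreal \<bar>\<rho>\<bar> * (ennreal (\<rho> powr (\<beta> - 1)) * ?I) = ennreal (\<rho> powr \<beta>) * ?I"
    using assms by (simp add: mult.assoc[symmetric] ennreal_mult'[symmetric] powr_diff)
  finally have *: "ennreal (Gamma \<beta>) = ennreal (\<rho> powr \<beta>) * ?I" .
  have "?I = ennreal (\<rho> powr - \<beta>) * (ennreal (\<rho> powr \<beta>) * ?I)"
    using assms by (simp add: mult.assoc[symmetric] ennreal_mult'[symmetric] powr_add[symmetric])
  also have "\<dots> = ennreal (\<rho> powr - \<beta>) * ennreal (Gamma \<beta>)"
    by (simp only: *)
  also have "\<dots> = ennreal (Gamma \<beta> * \<rho> powr - \<beta>)"
    by (simp add: ennreal_mult'' mult.commute)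
  finally show ?thesis .
qed

lemma has_bochner_integral_gamma_kernel:
  fixes \<beta> \<rho> :: real
  assumes "0 < \<beta>" "0 < \<rho>"
  shows "has_bochner_integral lborel (\<lambda>w. indicator {0<..} w * (w powr (\<beta> - 1) * exp (- w * \<rho>)))
    (Gamma \<beta> * \<rho> powr - \<beta>)"
  by (rule has_bochner_integral_nn_integral)
    (use nn_integral_gamma_kernel[OF assms] assms in \<open>auto simp: Gamma_real_pos less_imp_le\<close>)

text \<open>In the form that the measurability prover can chain: joint measurability of a curried function.\<close>

lemma borel_measurable_compose2:
  fixes g :: "real \<Rightarrow> real \<Rightarrow> real"
  assumes "(\<lambda>(x, y). g x y) \<in> borel_measurable borel"
    and "u \<in> borel_measurable M" "v \<in> borel_measurable M"
  shows "(\<lambda>z. g (u z) (v z)) \<in> borel_measurable M"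
  using measurable_compose[OF borel_measurable_Pair[OF assms(2,3)] assms(1)] by simp

text \<open>Mixtures of probability densities \<open>q(\<cdot>, w)\<close>, \<open>w > 0\<close>, against a gamma weight of total
mass \<open>\<rho>^(- \<beta>)\<close>.  The filter (mixing subordinator densities, rate \<open>\<mu>\<close>) and the covariance (mixing
densities of the independent sum, rate \<open>\<mu>\<^sup>2\<close>) are both of this form.\<close>

locale gamma_mixture =
  fixes q :: "real \<Rightarrow> real \<Rightarrow> real" and \<beta> \<rho> :: real and f :: "real \<Rightarrow> real"
  assumes pos: "0 < \<beta>" "0 < \<rho>"
    and q_measurable: "(\<lambda>(x, w). q x w) \<in> borel_measurable borel"
    and q_nonneg: "\<And>x w. 0 < w \<Longrightarrow> 0 \<le> q x w"
    and q_integral: "\<And>w. 0 < w \<Longrightarrow> has_bochner_integral lborel (\<lambda>x. q x w) 1"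
    and f_def: "\<And>x. f x = 1 / Gamma \<beta> * (LBINT w:{0<..}. w powr (\<beta> - 1) * exp (- w * \<rho>) * q x w)"
begin

definition kernel :: "real \<Rightarrow> real" where
  "kernel w = indicator {0<..} w * (w powr (\<beta> - 1) * exp (- w * \<rho>))"

lemmas q_measurable_compose [measurable (raw)] = borel_measurable_compose2[OF q_measurable]

lemma kernel_measurable [measurable]: "kernel \<in> borel_measurable borel"
  unfolding kernel_def by measurable

lemma kernel_nonneg: "0 \<le> kernel w"
  by (simp add: kernel_def)

lemma kernel_integrable: "integrable lborel kernel"
  using has_bochner_integral_gamma_kernel[OF pos]
  unfolding kernel_def has_bochner_integral_iff by blast

lemma f_eq: "f x = 1 / Gamma \<beta> * (LBINT w. kernel w * q x w)"
  unfolding f_def set_lebesgue_integral_def kernel_def by (simp add: mult.assoc)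

lemma mixture_nonneg: "0 \<le> f x"
  unfolding f_eq
  by (intro mult_nonneg_nonneg integral_nonneg)
    (use pos q_nonneg in \<open>auto simp: kernel_def indicator_def Gamma_real_pos less_imp_le\<close>)

lemma integrable_pair:
  fixes e :: "real \<Rightarrow> complex"
  assumes [measurable]: "e \<in> borel_measurable borel" and e: "\<And>x. norm (e x) \<le> 1"
  shows "integrable (lborel \<Otimes>\<^sub>M lborel) (\<lambda>(w, x). e x * of_real (kernel w * q x w))"
proof (rule Bochner_Integration.integrable_bound)
  show "integrable (lborel \<Otimes>\<^sub>M lborel) (\<lambda>(w, x). kernel w * q x w)"
  proof (rule lborel_pair.Fubini_integrable)
    have "(LBINT x. norm (kernel w * q x w)) = kernel w" for w
    proof (cases "0 < w")
      case True
      then have "(LBINT x. norm (kernel w * q x w)) = (LBINT x. kernel w * q x w)"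
        using kernel_nonneg q_nonneg by (intro Bochner_Integration.integral_cong) (auto simp: abs_mult)
      also have "\<dots> = kernel w"
        using q_integral[OF True] by (simp add: has_bochner_integral_integral_eq)
      finally show ?thesis .
    qed (simp add: kernel_def)
    then show "integrable lborel (\<lambda>w. LBINT x. norm (case (w, x) of (w, x) \<Rightarrow> kernel w * q x w))"
      using kernel_integrable by simp
    show "AE w in lborel. integrable lborel (\<lambda>x. case (w, x) of (w, x) \<Rightarrow> kernel w * q x w)"
    proof (rule AE_I2)
      fix w
      show "integrable lborel (\<lambda>x. case (w, x) of (w, x) \<Rightarrow> kernel w * q x w)"
        using q_integral[of w, THEN integrable.intros]
        by (cases "0 < w") (auto simp: kernel_def)
    qed
  qed measurable
  show "(\<lambda>(w, x). e x * of_real (kernel w * q x w)) \<in> borel_measurable (lborel \<Otimes>\<^sub>M lborel)"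
    by measurable
  show "AE p in lborel \<Otimes>\<^sub>M lborel. norm (case p of (w, x) \<Rightarrow> e x * of_real (kernel w * q x w))
      \<le> norm (case p of (w, x) \<Rightarrow> kernel w * q x w)"
    using e by (intro AE_I2) (auto simp: norm_mult abs_mult intro!: mult_left_le_one_le)
qed

lemma f_mult_eq: "e x * of_real (f x) = of_real (1 / Gamma \<beta>) * (LINT w|lborel. e x * of_real (kernel w * q x w))"
  for e :: "real \<Rightarrow> complex"
proof -
  have *: "(LINT w|lborel. e x * of_real (kernel w * q x w)) = e x * of_real (LINT w|lborel. kernel w * q x w)"
    by (simp only: integral_mult_right_zero integral_complex_of_real)
  show ?thesis unfolding f_eq * by (simp only: of_real_mult mult_ac)
qed

lemma mixture_integrable: "integrable lborel f"
proof -
  have "integrable lborel (\<lambda>x. LINT w|lborel. (1::complex) * of_real (kernel w * q x w))"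
    using lborel_pair.integrable_snd[OF integrable_pair[of "\<lambda>_. 1"]] by simp
  then have "integrable lborel (\<lambda>x. (1::complex) * of_real (f x))"
    unfolding f_mult_eq[of "\<lambda>_. 1"] by (intro integrable_mult_right) auto
  then show ?thesis by (simp add: complex_of_real_integrable_eq)
qed

text \<open>The reason for mixing with a gamma weight: an exponential family \<open>e^(- w \<theta>)\<close> of transforms is turned
into the power \<open>(\<rho> + \<theta>)^(- \<beta>)\<close>.  The bounded function \<open>e\<close> will be a Laplace kernel for the filter
and a Fourier kernel for the covariance.\<close>

lemma mixture_integral:
  fixes e :: "real \<Rightarrow> complex"
  assumes [measurable]: "e \<in> borel_measurable borel" and e: "\<And>x. norm (e x) \<le> 1" and "0 \<le> \<theta>"
    and q: "\<And>w. 0 < w \<Longrightarrow> (LINT x|lborel. e x * of_real (q x w)) = of_real (exp (- w * \<theta>))"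
  shows "(LINT x|lborel. e x * of_real (f x)) = of_real ((\<rho> + \<theta>) powr - \<beta>)"
proof -
  have k: "of_real (kernel w) * (LINT x|lborel. e x * of_real (q x w))
      = complex_of_real (indicator {0<..} w * (w powr (\<beta> - 1) * exp (- w * (\<rho> + \<theta>))))" for w
    by (cases "0 < w") (simp_all add: q kernel_def algebra_simps exp_diff exp_minus field_simps)
  have "(LINT x|lborel. e x * of_real (f x))
      = of_real (1 / Gamma \<beta>) * (LINT x|lborel. LINT w|lborel. e x * of_real (kernel w * q x w))"
    by (simp only: f_mult_eq integral_mult_right_zero)
  also have "(LINT x|lborel. LINT w|lborel. e x * of_real (kernel w * q x w))
      = (LINT w|lborel. LINT x|lborel. e x * of_real (kernel w * q x w))"
    by (rule lborel_pair.Fubini_integral[OF integrable_pair[of e]]) (use e in auto)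
  also have "\<dots> = (LINT w|lborel. of_real (kernel w) * (LINT x|lborel. e x * of_real (q x w)))"
    by (simp only: integral_mult_right_zero[symmetric] of_real_mult mult_ac)
  also have "\<dots> = complex_of_real (LBINT w. indicator {0<..} w * (w powr (\<beta> - 1) * exp (- w * (\<rho> + \<theta>))))"
    unfolding k by (rule integral_complex_of_real)
  also have "\<dots> = of_real (Gamma \<beta> * (\<rho> + \<theta>) powr - \<beta>)"
    using has_bochner_integral_gamma_kernel[of \<beta> "\<rho> + \<theta>"] pos \<open>0 \<le> \<theta>\<close>
    by (simp add: has_bochner_integral_integral_eq)
  finally show ?thesis
    using Gamma_real_pos[OF pos(1)] by simp
qed

end

section \<open>Filtered noise and autocorrelation\<close>

definition autocorrelation :: "(real \<Rightarrow> real) \<Rightarrow> real \<Rightarrow> real" where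
  "autocorrelation K h = (LBINT x. K x * K (x + h))"

lemma integrable_autocorrelation_pair:
  fixes K :: "real \<Rightarrow> real"
  assumes K: "integrable lborel K"
  shows "integrable (lborel \<Otimes>\<^sub>M lborel) (\<lambda>(x, h). K x * K (x + h))"
proof (rule lborel_pair.Fubini_integrable)
  have [measurable]: "K \<in> borel_measurable borel" using K by auto
  show "(\<lambda>(x, h). K x * K (x + h)) \<in> borel_measurable (lborel \<Otimes>\<^sub>M lborel)" by measurable
  have shift: "integrable lborel (\<lambda>h. K (x + h))" for x
    using lborel_integrable_real_affine[OF K, of 1 x] by simp
  have "(LBINT h. norm (K (x + h))) = (LBINT h. norm (K h))" for x
    using lborel_integral_real_affine[of 1 "\<lambda>h. norm (K h)" x] by simp
  then show "integrable lborel (\<lambda>x. LBINT h. norm (case (x, h) of (x, h) \<Rightarrow> K x * K (x + h)))"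
    using K by (simp add: abs_mult)
  show "AE x in lborel. integrable lborel (\<lambda>h. case (x, h) of (x, h) \<Rightarrow> K x * K (x + h))"
    using shift by simp
qed

lemma integrable_autocorrelation:
  assumes "integrable lborel K"
  shows "integrable lborel (autocorrelation K)"
  unfolding autocorrelation_def
  using lborel_pair.integrable_snd[OF integrable_autocorrelation_pair[OF assms]] by simp

text \<open>Writing \<open>h = (x + h) - x\<close> in the exponent splits the double integral into \<open>K^\<close> and its conjugate.\<close>

lemma fourier_autocorrelation:
  assumes K: "integrable lborel K"
  shows "(LINT h|lborel. iexp (\<tau> * h) * of_real (autocorrelation K h))
    = of_real ((norm (LINT x|lborel. iexp (\<tau> * x) * of_real (K x)))\<^sup>2)" (is "_ = of_real ((norm ?F)\<^sup>2)")
proof -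
  have [measurable]: "K \<in> borel_measurable borel" using K by auto
  have int: "integrable (lborel \<Otimes>\<^sub>M lborel) (\<lambda>(x, h). iexp (\<tau> * h) * of_real (K x * K (x + h)))"
    by (rule Bochner_Integration.integrable_bound[OF integrable_autocorrelation_pair[OF K]])
      (auto simp: norm_mult intro!: AE_I2)
  have "(LINT h|lborel. iexp (\<tau> * h) * of_real (autocorrelation K h))
      = (LINT h|lborel. LINT x|lborel. iexp (\<tau> * h) * of_real (K x * K (x + h)))"
    by (simp only: autocorrelation_def integral_mult_right_zero integral_complex_of_real)
  also have "\<dots> = (LINT x|lborel. LINT h|lborel. iexp (\<tau> * h) * of_real (K x * K (x + h)))"
    by (rule lborel_pair.Fubini_integral[OF int])
  also have "\<dots> = (LINT x|lborel. cnj (iexp (\<tau> * x) * of_real (K x)) * ?F)"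
  proof (rule Bochner_Integration.integral_cong[OF refl])
    fix x
    have phase: "iexp (\<tau> * h) = cnj (iexp (\<tau> * x)) * iexp (\<tau> * (x + h))" for h
      by (simp add: exp_cnj mult_exp_exp algebra_simps)
    have "(LINT h|lborel. iexp (\<tau> * h) * of_real (K x * K (x + h)))
        = (LINT h|lborel. cnj (iexp (\<tau> * x) * of_real (K x)) * (iexp (\<tau> * (x + h)) * of_real (K (x + h))))"
      by (intro Bochner_Integration.integral_cong[OF refl], subst phase)
        (simp only: of_real_mult complex_cnj_mult complex_cnj_complex_of_real mult_ac)
    also have "\<dots> = cnj (iexp (\<tau> * x) * of_real (K x)) * (LINT h|lborel. iexp (\<tau> * (x + h)) * of_real (K (x + h)))"
      by (rule integral_mult_right_zero)
    also have "(LINT h|lborel. iexp (\<tau> * (x + h)) * of_real (K (x + h))) = ?F"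
      using lborel_integral_real_affine[of 1 "\<lambda>h. iexp (\<tau> * h) * of_real (K h)" x] by simp
    finally show "(LINT h|lborel. iexp (\<tau> * h) * of_real (K x * K (x + h)))
      = cnj (iexp (\<tau> * x) * of_real (K x)) * ?F" .
  qed
  also have "\<dots> = cnj ?F * ?F"
    by (simp only: integral_mult_left_zero Bochner_Integration.integral_cnj)
  also have "\<dots> = of_real ((norm ?F)\<^sup>2)"
    by (simp only: complex_norm_square mult.commute)
  finally show ?thesis .
qed

lemma nn_integral_convolution:
  fixes k r :: "real \<Rightarrow> ennreal"
  assumes [measurable]: "k \<in> borel_measurable borel" "r \<in> borel_measurable borel"
  shows "(\<integral>\<^sup>+x. \<integral>\<^sup>+t. k (x - t) * r t \<partial>lborel \<partial>lborel) = (\<integral>\<^sup>+x. k x \<partial>lborel) * (\<integral>\<^sup>+t. r t \<partial>lborel)"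
proof -
  have shift: "(\<integral>\<^sup>+x. k (x - t) \<partial>lborel) = (\<integral>\<^sup>+x. k x \<partial>lborel)" for t
    using nn_integral_real_affine[of k 1 "- t"] by simp
  have "(\<integral>\<^sup>+x. \<integral>\<^sup>+t. k (x - t) * r t \<partial>lborel \<partial>lborel) = (\<integral>\<^sup>+t. \<integral>\<^sup>+x. k (x - t) * r t \<partial>lborel \<partial>lborel)"
    by (rule lborel_pair.Fubini') measurable
  then show ?thesis by (simp add: nn_integral_multc nn_integral_cmult shift)
qed

lemma nn_integral_reflect:
  fixes k :: "real \<Rightarrow> ennreal"
  assumes [measurable]: "k \<in> borel_measurable borel"
  shows "(\<integral>\<^sup>+s. k (x - s) \<partial>lborel) = (\<integral>\<^sup>+s. k s \<partial>lborel)"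
  using nn_integral_real_affine[of k "- 1" x] by simp

text \<open>Integrability of all factors at once, which justifies every exchange of integrals below.  The
product \<open>\<phi> t \<cdot> \<psi> s\<close> is dominated by \<open>(\<phi> t)\<^sup>2 + (\<psi> s)\<^sup>2\<close>; for each of the two squares the
remaining integrals are those of the convolution of integrable functions.\<close>

lemma integrable_filter_triple:
  assumes K: "integrable lborel K" and \<phi>: "square_integrable \<phi>" and \<psi>: "square_integrable \<psi>"
  shows "integrable (lborel \<Otimes>\<^sub>M (lborel \<Otimes>\<^sub>M lborel))
    (\<lambda>(x, s, t). K (x - t) * K (x - s) * \<phi> t * \<psi> s)"
proof -
  interpret T: pair_sigma_finite lborel "lborel \<Otimes>\<^sub>M lborel :: (real \<times> real) measure" ..
  have [measurable]: "K \<in> borel_measurable borel" using K by auto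
  have [measurable]: "\<phi> \<in> borel_measurable borel" "\<psi> \<in> borel_measurable borel"
    using \<phi> \<psi> by (auto simp: square_integrable_def)
  define k where "k x = ennreal \<bar>K x\<bar>" for x
  have [measurable]: "k \<in> borel_measurable borel" unfolding k_def by measurable
  have k: "(\<integral>\<^sup>+x. k x \<partial>lborel) < \<infinity>"
    using K unfolding k_def integrable_iff_bounded by simp
  have sq: "(\<integral>\<^sup>+x. ennreal ((u x)\<^sup>2) \<partial>lborel) < \<infinity>" if "square_integrable u" for u
    using that unfolding square_integrable_def integrable_iff_bounded by simp
  have "sigma_finite_measure (lborel \<Otimes>\<^sub>M lborel :: (real \<times> real) measure)"
    by (simp add: lborel_prod lborel.sigma_finite_measure_axioms)
  note fst = sigma_finite_measure.nn_integral_fst[OF this]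
  have 1: "(\<integral>\<^sup>+s. \<integral>\<^sup>+t. k (x - t) * k (x - s) * r t \<partial>lborel \<partial>lborel)
      = (\<integral>\<^sup>+x. k x \<partial>lborel) * (\<integral>\<^sup>+t. k (x - t) * r t \<partial>lborel)"
    if [measurable]: "r \<in> borel_measurable borel" for r x
  proof -
    have "(\<integral>\<^sup>+t. k (x - t) * k (x - s) * r t \<partial>lborel) = k (x - s) * (\<integral>\<^sup>+t. k (x - t) * r t \<partial>lborel)" for s
      by (subst nn_integral_cmult[symmetric]) (auto simp: mult_ac)
    then show ?thesis by (simp add: nn_integral_multc nn_integral_reflect)
  qed
  have 2: "(\<integral>\<^sup>+s. \<integral>\<^sup>+t. k (x - t) * k (x - s) * r s \<partial>lborel \<partial>lborel)
      = (\<integral>\<^sup>+x. k x \<partial>lborel) * (\<integral>\<^sup>+s. k (x - s) * r s \<partial>lborel)"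
    if [measurable]: "r \<in> borel_measurable borel" for r x
    by (simp add: nn_integral_multc nn_integral_reflect mult.assoc nn_integral_cmult)
  have fin: "(\<integral>\<^sup>+x. (\<integral>\<^sup>+x. k x \<partial>lborel) * (\<integral>\<^sup>+t. k (x - t) * ennreal ((u t)\<^sup>2) \<partial>lborel) \<partial>lborel) < \<infinity>"
    if u: "square_integrable u" for u
  proof -
    have [measurable]: "u \<in> borel_measurable borel" using u by (auto simp: square_integrable_def)
    have "(\<integral>\<^sup>+x. (\<integral>\<^sup>+x. k x \<partial>lborel) * (\<integral>\<^sup>+t. k (x - t) * ennreal ((u t)\<^sup>2) \<partial>lborel) \<partial>lborel)
        = (\<integral>\<^sup>+x. k x \<partial>lborel) * ((\<integral>\<^sup>+x. k x \<partial>lborel) * (\<integral>\<^sup>+t. ennreal ((u t)\<^sup>2) \<partial>lborel))"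
      by (subst nn_integral_cmult) (auto simp: nn_integral_convolution[of k "\<lambda>t. ennreal ((u t)\<^sup>2)"])
    also have "\<dots> < \<infinity>" using k sq[OF u] by (auto simp: ennreal_mult_less_top)
    finally show ?thesis .
  qed
  have dom: "integrable (lborel \<Otimes>\<^sub>M (lborel \<Otimes>\<^sub>M lborel))
      (\<lambda>(x, s, t). \<bar>K (x - t)\<bar> * \<bar>K (x - s)\<bar> * (\<phi> t)\<^sup>2)"
    "integrable (lborel \<Otimes>\<^sub>M (lborel \<Otimes>\<^sub>M lborel))
      (\<lambda>(x, s, t). \<bar>K (x - t)\<bar> * \<bar>K (x - s)\<bar> * (\<psi> s)\<^sup>2)"
  proof -
    have "(\<integral>\<^sup>+p. ennreal (norm (case p of (x, s, t) \<Rightarrow> \<bar>K (x - t)\<bar> * \<bar>K (x - s)\<bar> * (\<phi> t)\<^sup>2)) \<partial>(lborel \<Otimes>\<^sub>M (lborel \<Otimes>\<^sub>M lborel)))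
        = (\<integral>\<^sup>+x. \<integral>\<^sup>+s. \<integral>\<^sup>+t. k (x - t) * k (x - s) * ennreal ((\<phi> t)\<^sup>2) \<partial>lborel \<partial>lborel \<partial>lborel)"
      by (simp add: fst[symmetric] lborel.nn_integral_fst[symmetric] k_def ennreal_mult')
    also have "\<dots> < \<infinity>" using fin[OF \<phi>] by (simp add: 1)
    finally show "integrable (lborel \<Otimes>\<^sub>M (lborel \<Otimes>\<^sub>M lborel))
      (\<lambda>(x, s, t). \<bar>K (x - t)\<bar> * \<bar>K (x - s)\<bar> * (\<phi> t)\<^sup>2)"
      unfolding integrable_iff_bounded by simp
    have "(\<integral>\<^sup>+p. ennreal (norm (case p of (x, s, t) \<Rightarrow> \<bar>K (x - t)\<bar> * \<bar>K (x - s)\<bar> * (\<psi> s)\<^sup>2)) \<partial>(lborel \<Otimes>\<^sub>M (lborel \<Otimes>\<^sub>M lborel)))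
        = (\<integral>\<^sup>+x. \<integral>\<^sup>+s. \<integral>\<^sup>+t. k (x - t) * k (x - s) * ennreal ((\<psi> s)\<^sup>2) \<partial>lborel \<partial>lborel \<partial>lborel)"
      by (simp add: fst[symmetric] lborel.nn_integral_fst[symmetric] k_def ennreal_mult')
    also have "\<dots> < \<infinity>" using fin[OF \<psi>] by (simp add: 2)
    finally show "integrable (lborel \<Otimes>\<^sub>M (lborel \<Otimes>\<^sub>M lborel))
      (\<lambda>(x, s, t). \<bar>K (x - t)\<bar> * \<bar>K (x - s)\<bar> * (\<psi> s)\<^sup>2)"
      unfolding integrable_iff_bounded by simp
  qed
  show ?thesis
  proof (rule Bochner_Integration.integrable_bound[OF Bochner_Integration.integrable_add[OF dom]])
    show "(\<lambda>(x, s, t). K (x - t) * K (x - s) * \<phi> t * \<psi> s) \<in> borel_measurable (lborel \<Otimes>\<^sub>M (lborel \<Otimes>\<^sub>M lborel))"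
      by measurable
    have "\<bar>a * b * c * d\<bar> \<le> \<bar>a\<bar> * \<bar>b\<bar> * c\<^sup>2 + \<bar>a\<bar> * \<bar>b\<bar> * d\<^sup>2" for a b c d :: real
    proof -
      have "2 * (\<bar>c\<bar> * \<bar>d\<bar>) \<le> c\<^sup>2 + d\<^sup>2"
        using sum_squares_bound[of "\<bar>c\<bar>" "\<bar>d\<bar>"] by simp
      then have "\<bar>c\<bar> * \<bar>d\<bar> \<le> c\<^sup>2 + d\<^sup>2"
        using mult_nonneg_nonneg[of "\<bar>c\<bar>" "\<bar>d\<bar>"] by linarith
      then have "\<bar>a * b\<bar> * (\<bar>c\<bar> * \<bar>d\<bar>) \<le> \<bar>a * b\<bar> * (c\<^sup>2 + d\<^sup>2)"
        by (rule mult_left_mono) simp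
      then show ?thesis by (simp add: abs_mult distrib_left mult.assoc)
    qed
    then show "AE p in lborel \<Otimes>\<^sub>M (lborel \<Otimes>\<^sub>M lborel).
        norm (case p of (x, s, t) \<Rightarrow> K (x - t) * K (x - s) * \<phi> t * \<psi> s)
        \<le> norm ((case p of (x, s, t) \<Rightarrow> \<bar>K (x - t)\<bar> * \<bar>K (x - s)\<bar> * (\<phi> t)\<^sup>2) +
                (case p of (x, s, t) \<Rightarrow> \<bar>K (x - t)\<bar> * \<bar>K (x - s)\<bar> * (\<psi> s)\<^sup>2))"
      by (intro AE_I2) (auto simp: abs_of_nonneg)
  qed
qed

lemma fun_convolution_eq: "fun_convolution K \<phi> x = (LBINT t. K (x - t) * \<phi> t)"
  unfolding fun_convolution_def
  using lborel_integral_real_affine[of "- 1" "\<lambda>y. K y * \<phi> (x - y)" x] by simp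

lemma fun_convolution_measurable:
  assumes [measurable]: "K \<in> borel_measurable borel" "\<phi> \<in> borel_measurable borel"
  shows "fun_convolution K \<phi> \<in> borel_measurable borel"
  unfolding fun_convolution_def by measurable

text \<open>Both sides are iterated integrals of \<open>K (x - t) \<cdot> K (x - s) \<cdot> \<phi> t \<cdot> \<psi> s\<close>: integrating over \<open>t, s\<close>
first gives the product of convolutions, integrating over \<open>x\<close> first gives the autocorrelation.
The first part, with \<open>\<psi> = \<phi>\<close>, is Young's inequality in the form needed for the noise to accept
\<open>K * \<phi>\<close> as a test function.\<close>

lemma fun_convolution_product:
  assumes K: "integrable lborel K" and \<phi>: "square_integrable \<phi>" and \<psi>: "square_integrable \<psi>"
  shows "integrable lborel (\<lambda>x. fun_convolution K \<phi> x * fun_convolution K \<psi> x)"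
    and "(LBINT x. fun_convolution K \<phi> x * fun_convolution K \<psi> x)
      = (LBINT s. LBINT t. autocorrelation K (t - s) * \<phi> t * \<psi> s)"
proof -
  interpret T: pair_sigma_finite lborel "lborel \<Otimes>\<^sub>M lborel :: (real \<times> real) measure" ..
  have [measurable]: "K \<in> borel_measurable borel" using K by auto
  have [measurable]: "\<phi> \<in> borel_measurable borel" "\<psi> \<in> borel_measurable borel"
    using \<phi> \<psi> by (auto simp: square_integrable_def)
  note [measurable] = fun_convolution_measurable
  define V where "V x p = K (x - snd p) * K (x - fst p) * \<phi> (snd p) * \<psi> (fst p)" for x and p :: "real \<times> real"
  have V: "integrable (lborel \<Otimes>\<^sub>M (lborel \<Otimes>\<^sub>M lborel)) (\<lambda>(x, p). V x p)"
    using integrable_filter_triple[OF K \<phi> \<psi>] by (simp add: V_def case_prod_beta')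
  have AE: "AE x in lborel. integral\<^sup>L (lborel \<Otimes>\<^sub>M lborel) (V x) = fun_convolution K \<phi> x * fun_convolution K \<psi> x"
    using T.AE_integrable_fst[OF V]
  proof eventually_elim
    case (elim x)
    then have "integral\<^sup>L (lborel \<Otimes>\<^sub>M lborel) (V x) = (LBINT s. LBINT t. V x (s, t))"
      by (rule lborel_pair.integral_fst'[symmetric])
    also have "\<dots> = (LBINT s. (K (x - s) * \<psi> s) * (LBINT t. K (x - t) * \<phi> t))"
      unfolding V_def fst_conv snd_conv
      by (simp only: integral_mult_right_zero[symmetric] mult_ac)
    also have "\<dots> = fun_convolution K \<phi> x * fun_convolution K \<psi> x"
      by (simp add: fun_convolution_eq)
    finally show ?case .
  qed
  have int: "integrable lborel (\<lambda>x. integral\<^sup>L (lborel \<Otimes>\<^sub>M lborel) (V x))"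
    by (rule T.integrable_fst[OF V])
  show "integrable lborel (\<lambda>x. fun_convolution K \<phi> x * fun_convolution K \<psi> x)"
    using int by (rule integrable_cong_AE_imp) (use AE in \<open>auto elim: eventually_mono\<close>)
  have "(LBINT x. fun_convolution K \<phi> x * fun_convolution K \<psi> x) = (LBINT x. integral\<^sup>L (lborel \<Otimes>\<^sub>M lborel) (V x))"
    using int AE by (intro integral_cong_AE) (auto elim: eventually_mono)
  also have "\<dots> = (LINT p|(lborel \<Otimes>\<^sub>M lborel). LINT x|lborel. V x p)"
    by (rule T.Fubini_integral[OF V, symmetric])
  also have "\<dots> = (LBINT s. LBINT t. LBINT x. V x (s, t))"
    by (rule lborel_pair.integral_fst'[symmetric]) (rule T.integrable_snd[OF V])
  also have "\<dots> = (LBINT s. LBINT t. autocorrelation K (t - s) * \<phi> t * \<psi> s)"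
  proof (intro Bochner_Integration.integral_cong refl)
    fix s t
    have "(LBINT x. V x (s, t)) = (LBINT x. K (x - t) * K (x - s)) * \<phi> t * \<psi> s"
      unfolding V_def fst_conv snd_conv by (simp only: integral_mult_left_zero)
    also have "(LBINT x. K (x - t) * K (x - s)) = autocorrelation K (t - s)"
      unfolding autocorrelation_def
      using lborel_integral_real_affine[of 1 "\<lambda>x. K (x - t) * K (x - s)" t] by (simp add: algebra_simps)
    finally show "(LBINT x. V x (s, t)) = autocorrelation K (t - s) * \<phi> t * \<psi> s" .
  qed
  finally show "(LBINT x. fun_convolution K \<phi> x * fun_convolution K \<psi> x)
      = (LBINT s. LBINT t. autocorrelation K (t - s) * \<phi> t * \<psi> s)" .
qed

lemma square_integrable_fun_convolution:
  assumes K: "integrable lborel K" and \<phi>: "square_integrable \<phi>"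
  shows "square_integrable (fun_convolution K \<phi>)"
  using fun_convolution_product(1)[OF K \<phi> \<phi>] fun_convolution_measurable[of K \<phi>] K \<phi>
  by (auto simp: square_integrable_def power2_eq_square)

section \<open>Uniqueness of the covariance function\<close>

lemma square_integrable_indicator:
  assumes "A \<in> sets borel" "emeasure lborel A < \<infinity>"
  shows "square_integrable (indicator A)"
proof -
  have "(\<lambda>x. (indicator A x :: real)\<^sup>2) = indicator A" by (auto simp: indicator_def)
  then show ?thesis using assms by (simp add: square_integrable_def)
qed

lemma AE_lborel_witness:
  assumes "AE x in lborel. P x" "a < (b::real)"
  obtains x where "a < x" "x < b" "P x"
proof -
  have "\<exists>x. a < x \<and> x < b \<and> P x"
  proof (rule ccontr)
    assume "\<not> ?thesis"
    with assms(1) have "AE x in lborel. x \<notin> {a<..<b}"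
      by (auto elim: eventually_mono)
    then have "emeasure lborel {a<..<b} = 0"
      by (subst (asm) AE_iff_measurable[of "{a<..<b}"]) auto
    with \<open>a < b\<close> show False by simp
  qed
  then show ?thesis using that by blast
qed

text \<open>Half-lines generate the Borel sets.  To work with measures, the signed functions are replaced by
the nonnegative \<open>f\<^sup>+ + g\<^sup>-\<close> and \<open>g\<^sup>+ + f\<^sup>-\<close>, which have the same difference as \<open>f\<close> and \<open>g\<close>.\<close>

lemma AE_eq_if_integrals_greaterThan_eq:
  fixes f g :: "real \<Rightarrow> real"
  assumes f: "integrable lborel f" and g: "integrable lborel g"
    and eq: "\<And>a. (LBINT x:{a<..}. f x) = (LBINT x:{a<..}. g x)"
  shows "AE x in lborel. f x = g x"
proof -
  have [measurable]: "f \<in> borel_measurable borel" "g \<in> borel_measurable borel" using f g by auto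
  define u where "u = (\<lambda>x. max (f x) 0 + max (- g x) 0)"
  define v where "v = (\<lambda>x. max (g x) 0 + max (- f x) 0)"
  have uv: "integrable lborel u" "integrable lborel v" "\<And>x. 0 \<le> u x" "\<And>x. 0 \<le> v x"
    using f g by (auto simp: u_def v_def)
  have [measurable]: "u \<in> borel_measurable borel" "v \<in> borel_measurable borel" using uv by auto
  have uv_diff: "u x - v x = f x - g x" for x by (auto simp: u_def v_def)
  have on: "set_integrable lborel {a<..} w" if "integrable lborel w" for w :: "real \<Rightarrow> real" and a
    unfolding set_integrable_def using that by (intro integrable_mult_indicator) auto
  have emeasure: "emeasure (density lborel w) {a<..} = ennreal (LBINT x:{a<..}. w x)"
    if "integrable lborel w" "\<And>x. 0 \<le> w x" for w :: "real \<Rightarrow> real" and a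
  proof -
    have [measurable]: "w \<in> borel_measurable borel" using that by auto
    have "emeasure (density lborel w) {a<..} = (\<integral>\<^sup>+x. ennreal (indicator {a<..} x *\<^sub>R w x) \<partial>lborel)"
      by (subst emeasure_density) (auto intro!: nn_integral_cong simp: indicator_def)
    also have "\<dots> = ennreal (LBINT x. indicator {a<..} x *\<^sub>R w x)"
      using on[OF that(1)] that(2) by (intro nn_integral_eq_integral) (auto simp: set_integrable_def)
    finally show ?thesis by (simp add: set_lebesgue_integral_def)
  qed
  have "(LBINT x:{a<..}. u x) = (LBINT x:{a<..}. v x)" for a
  proof -
    have "(LBINT x:{a<..}. u x) - (LBINT x:{a<..}. v x) = (LBINT x:{a<..}. f x - g x)"
      using on uv by (simp add: set_integral_diff(2)[symmetric] uv_diff)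
    also have "\<dots> = 0" using on f g eq[of a] by (simp add: set_integral_diff(2))
    finally show ?thesis by simp
  qed
  then have "density lborel u = density lborel v"
    by (intro measure_eqI_lessThan) (auto simp: emeasure uv)
  moreover have "(\<integral>\<^sup>+x. ennreal (u x) \<partial>lborel) \<noteq> \<infinity>"
    using uv by (subst nn_integral_eq_integral) auto
  ultimately have "AE x in lborel. ennreal (u x) = ennreal (v x)"
    by (subst (asm) finite_density_unique) auto
  then show ?thesis
    by eventually_elim (use uv uv_diff in \<open>simp add: ennreal_inj, smt (verit)\<close>)
qed

text \<open>Test with the indicator \<open>\<phi>\<close> of \<open>(a, n]\<close> and indicators \<open>\<psi>\<close> of subsets of \<open>[- 1, 0]\<close>: for almost
every \<open>s\<close> in \<open>[- 1, 0]\<close>, \<open>C\<close> and \<open>C'\<close> have the same integral over \<open>(a - s, n - s]\<close>.  Choose such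
shifts \<open>s\<^sub>n < 0\<close> that tend to \<open>0\<close>; in the limit the integrals over \<open>(a, \<infinity>)\<close> agree.\<close>

lemma translation_kernel_unique:
  fixes C C' :: "real \<Rightarrow> real"
  assumes C: "integrable lborel C" and C': "integrable lborel C'"
    and eq: "\<And>\<phi> \<psi>. square_integrable \<phi> \<Longrightarrow> square_integrable \<psi> \<Longrightarrow>
      (LBINT s. LBINT t. C (t - s) * \<phi> t * \<psi> s) = (LBINT s. LBINT t. C' (t - s) * \<phi> t * \<psi> s)"
  shows "AE h in lborel. C h = C' h"
proof (rule AE_eq_if_integrals_greaterThan_eq[OF C C'])
  fix a :: real
  define G where "G D n s = (LBINT u. D u * indicator {a<..real n} (u + s))" for D :: "real \<Rightarrow> real" and n s
  have G: "(LBINT t. D (t - s) * indicator {a<..real n} t * \<psi> s) = \<psi> s * G D n s" for D n s and \<psi> :: "real \<Rightarrow> real"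
    using lborel_integral_real_affine[of 1 "\<lambda>t. D (t - s) * indicator {a<..real n} t" s]
    by (simp add: G_def add.commute)
  have Gint: "integrable lborel (\<lambda>s. indicator {- 1..0} s * G D n s)" if D: "integrable lborel D" for D n
  proof (rule Bochner_Integration.integrable_bound)
    have [measurable]: "D \<in> borel_measurable borel" using D by auto
    show "integrable lborel (\<lambda>s. indicator {- 1..0::real} s * (LBINT u. \<bar>D u\<bar>))" by auto
    show "(\<lambda>s. indicator {- 1..0} s * G D n s) \<in> borel_measurable lborel" unfolding G_def by measurable
    have "\<bar>G D n s\<bar> \<le> (LBINT u. \<bar>D u\<bar>)" for s
    proof -
      have "\<bar>G D n s\<bar> \<le> (LBINT u. \<bar>D u * indicator {a<..real n} (u + s)\<bar>)"
        unfolding G_def by (rule integral_abs_bound)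
      also have "\<dots> \<le> (LBINT u. \<bar>D u\<bar>)"
        using D by (intro integral_mono') (auto simp: indicator_def)
      finally show ?thesis .
    qed
    then show "AE s in lborel. norm (indicator {- 1..0} s * G D n s) \<le> norm (indicator {- 1..0::real} s * (LBINT u. \<bar>D u\<bar>))"
      by (intro AE_I2) (auto simp: indicator_def intro: order.trans)
  qed
  have ae: "AE s in lborel. indicator {- 1..0} s * G C n s = indicator {- 1..0} s * G C' n s" for n
  proof (rule density_unique_real[OF Gint[OF C] Gint[OF C']])
    fix B :: "real set" assume "B \<in> sets lborel"
    then have [measurable]: "B \<in> sets borel" by simp
    have "square_integrable (indicator (B \<inter> {- 1..0}))"
      by (intro square_integrable_indicator emeasure_bounded_finite bounded_Int) auto
    moreover have "square_integrable (indicator {a<..real n})"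
      by (intro square_integrable_indicator emeasure_bounded_finite) auto
    ultimately have "(LBINT s. indicator (B \<inter> {- 1..0}) s * G C n s) = (LBINT s. indicator (B \<inter> {- 1..0}) s * G C' n s)"
      using eq[of "indicator {a<..real n}" "indicator (B \<inter> {- 1..0})"] by (simp only: G)
    then show "(LBINT s:B. indicator {- 1..0} s * G C n s) = (LBINT s:B. indicator {- 1..0} s * G C' n s)"
      by (simp add: set_lebesgue_integral_def indicator_inter_arith mult.assoc)
  qed
  have "\<exists>s. - 1 / real (Suc n) < s \<and> s < 0 \<and> G C n s = G C' n s" for n
  proof -
    have neg: "- 1 / real (Suc n) < 0" by (simp add: divide_neg_pos)
    obtain s where s: "- 1 / real (Suc n) < s" "s < 0"
        "indicator {- 1..0} s * G C n s = indicator {- 1..0} s * G C' n s"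
      using AE_lborel_witness[OF ae[of n] neg] by blast
    have "- 1 \<le> - 1 / real (Suc n)" by (simp add: field_simps)
    with s(1,2) have "- 1 \<le> s" by linarith
    with s(2) have "s \<in> {- 1..0}" by simp
    with s show ?thesis by auto
  qed
  then obtain s where s: "\<And>n. - 1 / real (Suc n) < s n" "\<And>n. s n < 0" "\<And>n. G C n (s n) = G C' n (s n)"
    by metis
  have s0: "s \<longlonglongrightarrow> 0"
  proof (rule tendsto_sandwich[of "\<lambda>n. - 1 / real (Suc n)" _ _ "\<lambda>_. 0"])
    have "(\<lambda>n. - (1 / real (Suc n))) \<longlonglongrightarrow> - 0"
      by (intro tendsto_minus LIMSEQ_Suc lim_1_over_n)
    then show "(\<lambda>n. - 1 / real (Suc n)) \<longlonglongrightarrow> 0" by simp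
  qed (use s in \<open>auto intro!: always_eventually less_imp_le\<close>)
  have lim: "(\<lambda>n. G D n (s n)) \<longlonglongrightarrow> (LBINT u:{a<..}. D u)" if D: "integrable lborel D" for D
  proof -
    have [measurable]: "D \<in> borel_measurable borel" using D by auto
    have "(\<lambda>n. LBINT u. D u * indicator {a<..real n} (u + s n)) \<longlonglongrightarrow> (LBINT u. D u * indicator {a<..} u)"
    proof (rule integral_dominated_convergence[where w = "\<lambda>u. \<bar>D u\<bar>"])
      show "AE u in lborel. (\<lambda>n. D u * indicator {a<..real n} (u + s n)) \<longlonglongrightarrow> D u * indicator {a<..} u"
      proof (rule AE_I2)
        fix u
        have us: "(\<lambda>n. u + s n) \<longlonglongrightarrow> u" using tendsto_add[OF tendsto_const s0, of u] by simp
        \<comment> \<open>Negative shifts make the half-open intervals converge to \<open>{a<..}\<close> also at the endpoint \<open>u = a\<close>.\<close>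
        have "eventually (\<lambda>n. indicator {a<..real n} (u + s n) = (indicator {a<..} u :: real)) sequentially"
        proof (cases "a < u")
          case True
          have "eventually (\<lambda>n. a < u + s n) sequentially" using order_tendstoD(1)[OF us True] .
          moreover have "eventually (\<lambda>n. u \<le> real n) sequentially"
            using filterlim_real_sequentially by (simp add: filterlim_at_top)
          ultimately show ?thesis
          proof eventually_elim
            case (elim n)
            then show ?case using s(2)[of n] True by (auto simp: indicator_def)
          qed
        next
          case False
          then show ?thesis using s(2) by (auto simp: indicator_def intro!: always_eventually) (smt (verit) s(2))
        qed
        then have "(\<lambda>n. indicator {a<..real n} (u + s n)) \<longlonglongrightarrow> (indicator {a<..} u :: real)"
          by (rule tendsto_eventually)
        then show "(\<lambda>n. D u * indicator {a<..real n} (u + s n)) \<longlonglongrightarrow> D u * indicator {a<..} u"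
          by (intro tendsto_intros)
      qed
    qed (use D in \<open>auto simp: indicator_def\<close>)
    then show ?thesis by (simp add: G_def set_lebesgue_integral_def mult.commute)
  qed
  show "(LBINT x:{a<..}. C x) = (LBINT x:{a<..}. C' x)"
    using lim[OF C] lim[OF C'] s(3) by (simp add: LIMSEQ_unique)
qed

section \<open>The filter built from the stable subordinator\<close>

locale stable_filter =
  fixes \<alpha> \<beta> \<mu> :: real and h :: "real \<Rightarrow> real \<Rightarrow> real" and K :: "real \<Rightarrow> real"
  assumes \<alpha>: "0 < \<alpha>" "\<alpha> < 1" and \<beta>: "0 < \<beta>" and \<mu>: "0 < \<mu>"
    and h: "stable_subordinator_density \<alpha> h"
    and K_def: "\<And>z. K z = (if z < 0 then 0
      else 1 / Gamma \<beta> * (LBINT s:{0<..}. s powr (\<beta> - 1) * exp (- s * \<mu>) * h z s))"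
begin

text \<open>The density is constrained only for \<open>z \<ge> 0\<close> and \<open>s > 0\<close>; extension by \<open>0\<close> makes it measurable
on the plane.\<close>

definition q :: "real \<Rightarrow> real \<Rightarrow> real" where
  "q z s = indicator ({0..} \<times> {0<..}) (z, s) * h z s"

lemma h_laplace: "0 < s \<Longrightarrow> 0 \<le> \<xi> \<Longrightarrow> (LBINT z. exp (- \<xi> * z) * q z s) = exp (- s * \<xi> powr \<alpha>)"
proof -
  assume "0 < s" "0 \<le> \<xi>"
  then have "(LBINT z. exp (- \<xi> * z) * q z s) = (LBINT z:{0..}. exp (- \<xi> * z) * h z s)"
    unfolding set_lebesgue_integral_def
    by (intro Bochner_Integration.integral_cong) (auto simp: q_def indicator_def)
  then show ?thesis
    using h \<open>0 < s\<close> \<open>0 \<le> \<xi>\<close> by (simp add: stable_subordinator_density_def)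
qed

sublocale gamma_mixture q \<beta> \<mu> K
proof
  show "(\<lambda>(x, w). q x w) \<in> borel_measurable borel"
  proof -
    have "(\<lambda>p. indicator ({0..} \<times> {0<..}) p *\<^sub>R (case p of (z, s) \<Rightarrow> h z s)) \<in> borel_measurable borel"
      using h by (simp add: stable_subordinator_density_def set_borel_measurable_def)
    also have "(\<lambda>p. indicator ({0..} \<times> {0<..}) p *\<^sub>R (case p of (z, s) \<Rightarrow> h z s)) = (\<lambda>(x, w). q x w)"
      by (auto simp: q_def fun_eq_iff)
    finally show ?thesis .
  qed
  show "0 \<le> q x w" if "0 < w" for x w
    using h that by (auto simp: q_def indicator_def stable_subordinator_density_def)
  show "has_bochner_integral lborel (\<lambda>x. q x w) 1" if "0 < w" for w
  proof -
    have "(LBINT x. q x w) = 1" using h_laplace[OF that, of 0] \<alpha> by simp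
    then show ?thesis
      using not_integrable_integral_eq[of lborel "\<lambda>x. q x w"] by (auto simp: has_bochner_integral_iff)
  qed
  show "K x = 1 / Gamma \<beta> * (LBINT w:{0<..}. w powr (\<beta> - 1) * exp (- w * \<mu>) * q x w)" for x
  proof (cases "x < 0")
    case False
    then have "(LBINT w:{0<..}. w powr (\<beta> - 1) * exp (- w * \<mu>) * q x w)
        = (LBINT w:{0<..}. w powr (\<beta> - 1) * exp (- w * \<mu>) * h x w)"
      by (intro set_lebesgue_integral_cong) (auto simp: q_def)
    with False show ?thesis by (simp add: K_def)
  qed (simp add: K_def q_def)
qed (use \<beta> \<mu> in auto)

lemma K_neg: "z < 0 \<Longrightarrow> K z = 0"
  by (simp add: K_def)

lemma laplace_transform:
  assumes "0 \<le> \<xi>"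
  shows "(LINT z|lborel. exp (- of_real \<xi> * of_real z) * of_real (K z)) = complex_of_real ((\<mu> + \<xi> powr \<alpha>) powr - \<beta>)"
proof -
  define e :: "real \<Rightarrow> complex" where "e z = (if z < 0 then 0 else of_real (exp (- \<xi> * z)))" for z
  have "(LINT z|lborel. exp (- of_real \<xi> * of_real z) * of_real (K z)) = (LINT z|lborel. e z * of_real (K z))"
    by (intro Bochner_Integration.integral_cong) (auto simp: e_def K_neg exp_of_real[symmetric])
  also have "\<dots> = complex_of_real ((\<mu> + \<xi> powr \<alpha>) powr - \<beta>)"
  proof (rule mixture_integral)
    show "e \<in> borel_measurable borel" unfolding e_def by measurable
    show "norm (e x) \<le> 1" for x using assms by (auto simp: e_def)
    fix w :: real assume w: "0 < w"
    have "(LINT x|lborel. e x * of_real (q x w)) = (LINT x|lborel. of_real (exp (- \<xi> * x) * q x w))"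
      by (intro Bochner_Integration.integral_cong) (auto simp: e_def q_def)
    also have "\<dots> = of_real (exp (- w * \<xi> powr \<alpha>))"
      unfolding integral_complex_of_real h_laplace[OF w assms] ..
    finally show "(LINT x|lborel. e x * of_real (q x w)) = of_real (exp (- w * \<xi> powr \<alpha>))" .
  qed simp
  finally show ?thesis .
qed

text \<open>The transform of the filter, with principal powers, so that it is holomorphic in the right
half-plane.\<close>

definition transfer :: "complex \<Rightarrow> complex" where
  "transfer \<zeta> = (of_real \<mu> + \<zeta> powr of_real \<alpha>) powr of_real (- \<beta>)"

text \<open>At \<open>\<tau> = 0\<close> the base of the inner power is \<open>0\<close>, which lies on the branch cut, so that
the limit argument is unavailable; there the value is the Laplace transform at \<open>0\<close>.\<close>

lemma fourier_norm:
  "(norm (LINT z|lborel. iexp (\<tau> * z) * of_real (K z)))\<^sup>2 =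
    (\<mu>\<^sup>2 + (\<bar>\<tau>\<bar> powr (2 * \<alpha>) + 2 * \<mu> * cos (pi * \<alpha> / 2) * \<bar>\<tau>\<bar> powr \<alpha>)) powr - \<beta>"
proof (cases "\<tau> = 0")
  case True
  have "(norm (LINT z|lborel. iexp (\<tau> * z) * of_real (K z)))\<^sup>2 = (\<mu> powr - \<beta>)\<^sup>2"
    using laplace_transform[of 0] \<alpha> True by simp
  also have "\<dots> = (\<mu>\<^sup>2) powr - \<beta>" using \<mu> by (simp add: power2_eq_square powr_mult)
  finally show ?thesis using True \<alpha> by simp
next
  case False
  have base: "of_real \<mu> + \<zeta> powr of_real \<alpha> \<notin> \<real>\<^sub>\<le>\<^sub>0" if "0 \<le> Re \<zeta>" "\<zeta> \<noteq> 0" for \<zeta>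
    using Re_powr_pos[OF that \<alpha>] \<mu> by (auto simp: complex_nonpos_Reals_iff)
  have slit: "\<zeta> \<notin> \<real>\<^sub>\<le>\<^sub>0" if "0 \<le> Re \<zeta>" "\<zeta> \<noteq> 0" for \<zeta>
    using that by (auto simp: complex_nonpos_Reals_iff complex_eq_iff)
  have right: "\<zeta> \<notin> \<real>\<^sub>\<le>\<^sub>0" "of_real \<mu> + \<zeta> powr of_real \<alpha> \<notin> \<real>\<^sub>\<le>\<^sub>0" if "0 < Re \<zeta>" for \<zeta>
    using slit[of \<zeta>] base[of \<zeta>] that by (cases "\<zeta> = 0"; simp)+
  \<comment> \<open>The sign makes \<open>e^(- \<zeta> z)\<close> equal to \<open>e^(i \<tau> z)\<close>.\<close>
  define \<zeta> where "\<zeta> = \<i> * of_real (- \<tau>)"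
  have \<zeta>: "Re \<zeta> = 0" "\<zeta> \<noteq> 0" using False by (auto simp: \<zeta>_def)
  have "(LINT z|lborel. exp (- \<zeta> * of_real z) * of_real (K z)) = transfer \<zeta>"
  proof (rule laplace_transform_eq_on_boundary[OF mixture_integrable K_neg])
    show "transfer holomorphic_on {\<zeta>. 0 < Re \<zeta>}"
      unfolding transfer_def
      by (intro holomorphic_intros) (use right in auto)
    show "isCont transfer \<zeta>"
      unfolding transfer_def
      by (intro continuous_intros) (use base slit \<zeta> in auto)
    fix \<xi> :: real assume "0 < \<xi>"
    then show "(LINT z|lborel. exp (- of_real \<xi> * of_real z) * of_real (K z)) = transfer (of_real \<xi>)"
      using laplace_transform[of \<xi>] \<mu> by (simp add: transfer_def powr_of_real add_pos_nonneg less_imp_le flip: of_real_add of_real_minus)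
  qed (use \<zeta> in auto)
  then have "norm (LINT z|lborel. iexp (\<tau> * z) * of_real (K z)) = norm (transfer \<zeta>)"
    by (simp add: \<zeta>_def mult.assoc)
  also have "\<dots> = norm (of_real \<mu> + \<zeta> powr of_real \<alpha>) powr - \<beta>"
    unfolding transfer_def by (simp add: norm_powr_real_powr')
  finally have "(norm (LINT z|lborel. iexp (\<tau> * z) * of_real (K z)))\<^sup>2
      = ((norm (of_real \<mu> + \<zeta> powr of_real \<alpha>))\<^sup>2) powr - \<beta>"
    by (simp add: power2_eq_square powr_mult)
  also have "(norm (of_real \<mu> + \<zeta> powr of_real \<alpha>))\<^sup>2
      = \<mu>\<^sup>2 + (\<bar>\<tau>\<bar> powr (2 * \<alpha>) + 2 * \<mu> * cos (pi * \<alpha> / 2) * \<bar>\<tau>\<bar> powr \<alpha>)"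
    unfolding \<zeta>_def using norm_add_imaginary_powr[of "- \<tau>" \<mu> \<alpha>] False by simp
  finally show ?thesis .
qed

end

section \<open>Densities of the independent sum\<close>

lemma density_integral_and_char:
  assumes X: "distributed N lborel X (\<lambda>x. ennreal (g x))" and g: "\<And>x. 0 \<le> g x" and N: "prob_space N"
  shows "has_bochner_integral lborel g 1"
    and "(LINT x|lborel. iexp (\<tau> * x) * of_real (g x)) = char (distr N borel X) \<tau>"
proof -
  have [measurable]: "g \<in> borel_measurable borel"
    using distributed_real_measurable[OF g X] by simp
  have D: "distr N borel X = density lborel (\<lambda>x. ennreal (g x))"
    using distributed_distr_eq_density[OF X] by (simp cong: distr_cong)
  have "emeasure (distr N borel X) UNIV = 1"
    using distributed_measurable[OF X] N
    by (subst emeasure_distr) (auto simp: prob_space.emeasure_space_1)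
  then have "(\<integral>\<^sup>+x. ennreal (g x) \<partial>lborel) = ennreal 1"
    by (simp add: D emeasure_density)
  then show "has_bochner_integral lborel g 1"
    using g by (intro has_bochner_integral_nn_integral) auto
  have "char (distr N borel X) \<tau> = (LINT x|lborel. g x *\<^sub>R iexp (\<tau> * x))"
    unfolding char_def D using g by (intro integral_density) auto
  then show "(LINT x|lborel. iexp (\<tau> * x) * of_real (g x)) = char (distr N borel X) \<tau>"
    by (simp add: scaleR_conv_of_real mult.commute)
qed

lemma independent_processes_indep_var:
  assumes N: "prob_space N" and ind: "independent_processes N S T" and w: "0 \<le> w"
  shows "prob_space.indep_var N borel (S w) borel (T w)"
proof -
  interpret prob_space N by (rule N)
  have "indep_var borel ((\<lambda>f. f w) \<circ> (\<lambda>\<omega>. \<lambda>w\<in>{0..}. S w \<omega>)) borel ((\<lambda>f. f w) \<circ> (\<lambda>\<omega>. \<lambda>w\<in>{0..}. T w \<omega>))"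
    using ind w unfolding independent_processes_def
    by (intro indep_var_compose) (auto intro!: measurable_component_singleton)
  then show ?thesis using w by (simp add: comp_def)
qed

text \<open>The convolution integral may diverge on a null set of \<open>x\<close>; off it, the integral of nonnegative
extended reals that gives the density of the sum is finite and equal to the real integral.\<close>

lemma sum_density_eq_convolution:
  fixes X Y :: "'n \<Rightarrow> real"
  assumes N: "prob_space N" and ind: "prob_space.indep_var N borel X borel Y"
    and X: "distributed N lborel X (\<lambda>x. ennreal (f x))" and f: "\<And>x. 0 \<le> f x"
    and Y: "distributed N lborel Y (\<lambda>x. ennreal (g x))" and g: "\<And>x. 0 \<le> g x"
    and XY: "distributed N lborel (\<lambda>\<omega>. X \<omega> + Y \<omega>) (\<lambda>x. ennreal (p x))" and p: "\<And>x. 0 \<le> p x"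
  shows "AE x in lborel. p x = (LBINT z. f (x - z) * g z)"
proof -
  interpret prob_space N by (rule N)
  have [measurable]: "f \<in> borel_measurable borel" "g \<in> borel_measurable borel"
    using distributed_real_measurable[OF f X] distributed_real_measurable[OF g Y] by simp_all
  have "AE x in lborel. ennreal (p x) = (\<integral>\<^sup>+z. ennreal (f (x - z)) * ennreal (g z) \<partial>lborel)"
    by (rule distributed_unique[OF XY distributed_convolution[OF ind X Y]])
  then show ?thesis
  proof eventually_elim
    case (elim x)
    then have eq: "(\<integral>\<^sup>+z. ennreal (f (x - z) * g z) \<partial>lborel) = ennreal (p x)"
      using f g by (simp add: ennreal_mult)
    have "has_bochner_integral lborel (\<lambda>z. f (x - z) * g z) (p x)"
      by (rule has_bochner_integral_nn_integral) (use eq f g p in auto)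
    then show ?case by (simp add: has_bochner_integral_integral_eq)
  qed
qed

section \<open>The covariance function\<close>

lemma is_covariance_function_filtered_noise:
  assumes \<E>: "gaussian_white_noise M v \<E>" and K: "integrable lborel K"
  shows "is_covariance_function M (filtered_noise \<E> K) (\<lambda>h. v * autocorrelation K h)"
  unfolding is_covariance_function_def
proof (intro conjI allI impI)
  show "integrable lborel (\<lambda>h. v * autocorrelation K h)"
    using integrable_autocorrelation[OF K] by simp
  fix \<phi> \<psi> assume "square_integrable \<phi> \<and> square_integrable \<psi>"
  then have sq: "square_integrable \<phi>" "square_integrable \<psi>" by auto
  have "(\<integral>\<omega>. filtered_noise \<E> K \<phi> \<omega> * filtered_noise \<E> K \<psi> \<omega> \<partial>M)
      = v * (LBINT t. fun_convolution K \<phi> t * fun_convolution K \<psi> t)"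
    unfolding filtered_noise_def
    using \<E> square_integrable_fun_convolution[OF K sq(1)] square_integrable_fun_convolution[OF K sq(2)]
    unfolding gaussian_white_noise_def by blast
  also have "\<dots> = (LBINT s. LBINT t. v * autocorrelation K (t - s) * \<phi> t * \<psi> s)"
    unfolding fun_convolution_product(2)[OF K sq]
    by (simp only: integral_mult_right_zero[symmetric] mult.assoc)
  finally show "(\<integral>\<omega>. filtered_noise \<E> K \<phi> \<omega> * filtered_noise \<E> K \<psi> \<omega> \<partial>M)
      = (LBINT s. LBINT t. v * autocorrelation K (t - s) * \<phi> t * \<psi> s)" .
qed

lemma is_covariance_function_unique:
  assumes "is_covariance_function M X C" "is_covariance_function M X C'"
  shows "AE h in lborel. C h = C' h"
  using assms unfolding is_covariance_function_def
  by (intro translation_kernel_unique) auto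

text \<open>The normalising constant \<open>(\<mu>\<^sup>2)^\<beta>\<close> of the gamma law is what separates the two formulas for the
covariance.\<close>

lemma expectation_gamma_time:
  assumes W: "distributed P lborel W (\<lambda>w. ennreal (gamma_density \<beta> (\<mu>\<^sup>2) w))"
    and [measurable]: "g \<in> borel_measurable borel" and "0 < \<beta>" "0 < \<mu>"
  shows "(\<integral>\<omega>. g (W \<omega>) \<partial>P) =
    \<mu> powr (2 * \<beta>) * (1 / Gamma \<beta> * (LBINT w:{0<..}. w powr (\<beta> - 1) * exp (- w * \<mu>\<^sup>2) * g w))"
proof -
  have \<mu>: "(\<mu>\<^sup>2) powr \<beta> = \<mu> powr (2 * \<beta>)"
    using \<open>0 < \<mu>\<close> by (simp add: power2_eq_square powr_mult flip: powr_add)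
  have "(\<integral>\<omega>. g (W \<omega>) \<partial>P) = (LBINT w. gamma_density \<beta> (\<mu>\<^sup>2) w * g w)"
    using W assms(3,4)
    by (intro distributed_integral[symmetric]) (auto simp: gamma_density_def Gamma_real_pos less_imp_le)
  also have "\<dots> = (LBINT w. \<mu> powr (2 * \<beta>) / Gamma \<beta> *
      (indicator {0<..} w * (w powr (\<beta> - 1) * exp (- w * \<mu>\<^sup>2) * g w)))"
    by (intro Bochner_Integration.integral_cong) (auto simp: gamma_density_def \<mu> mult_ac)
  also have "\<dots> = \<mu> powr (2 * \<beta>) / Gamma \<beta> * (LBINT w:{0<..}. w powr (\<beta> - 1) * exp (- w * \<mu>\<^sup>2) * g w)"
    unfolding set_lebesgue_integral_def real_scaleR_def by (rule integral_mult_right_zero)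
  finally show ?thesis by simp
qed

theorem theorem2p3:
  fixes M :: "'a measure" and N :: "'b measure" and P :: "'c measure"
    and \<alpha> \<beta> \<mu> \<sigma> :: real
    and \<E> X :: "(real \<Rightarrow> real) \<Rightarrow> 'a \<Rightarrow> real"
    and K :: "real \<Rightarrow> real"
    and h\<alpha> g1 g2 g12 :: "real \<Rightarrow> real \<Rightarrow> real"
    and S1 S2 :: "real \<Rightarrow> 'b \<Rightarrow> real"
    and W :: "'c \<Rightarrow> real"
  assumes "0 < \<alpha>" "\<alpha> < 1" and "0 < \<beta>" and "0 < \<mu>"
    and "gaussian_white_noise M (\<sigma>\<^sup>2) \<E>"
    and "stable_subordinator_density \<alpha> h\<alpha>"
    and "\<And>z. K z = (if z < 0 then 0
              else 1 / Gamma \<beta> * (LBINT s:{0<..}. s powr (\<beta> - 1) * exp (- s * \<mu>) * h\<alpha> z s))"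
    and "X = filtered_noise \<E> K"
    and "levy_process N S1" and "levy_process N S2"
    and "independent_processes N S1 S2"
    and "\<And>w \<tau>. w \<ge> 0 \<Longrightarrow>
           char (distr N borel (S1 w)) \<tau> = complex_of_real (exp (- (\<bar>\<tau>\<bar> powr (2 * \<alpha>)) * w))"
    and "\<And>w \<tau>. w \<ge> 0 \<Longrightarrow>
           char (distr N borel (S2 w)) \<tau> =
             complex_of_real (exp (- 2 * \<mu> * cos (pi * \<alpha> / 2) * \<bar>\<tau>\<bar> powr \<alpha> * w))"
    and "has_densities N S1 g1" and "has_densities N S2 g2"
    and "has_densities N (\<lambda>w \<omega>. S1 w \<omega> + S2 w \<omega>) g12"
    and "prob_space P"
    and "distributed P lborel W (\<lambda>w. ennreal (gamma_density \<beta> (\<mu>\<^sup>2) w))"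
  shows "(\<exists>C. is_covariance_function M X C) \<and>
         (\<forall>C. is_covariance_function M X C \<longrightarrow>
            (AE h in lborel. C h = \<sigma>\<^sup>2 / Gamma \<beta> *
               (LBINT w:{0<..}. w powr (\<beta> - 1) * exp (- w * \<mu>\<^sup>2) *
                  (LBINT z. g1 (h - z) w * g2 z w))) \<and>
            (AE h in lborel. C h = \<sigma>\<^sup>2 / \<mu> powr (2 * \<beta>) * (\<integral>\<omega>. g12 h (W \<omega>) \<partial>P)))"
proof -
  interpret K: stable_filter \<alpha> \<beta> \<mu> h\<alpha> K
    by unfold_locales (use assms in auto)
  have N: "prob_space N" using \<open>levy_process N S1\<close> by (simp add: levy_process_def)
  have g1: "(\<lambda>(x, w). g1 x w) \<in> borel_measurable borel" "\<And>x w. 0 < w \<Longrightarrow> 0 \<le> g1 x w"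
      "\<And>w. 0 < w \<Longrightarrow> distributed N lborel (S1 w) (\<lambda>x. ennreal (g1 x w))"
    and g2: "(\<lambda>(x, w). g2 x w) \<in> borel_measurable borel" "\<And>x w. 0 < w \<Longrightarrow> 0 \<le> g2 x w"
      "\<And>w. 0 < w \<Longrightarrow> distributed N lborel (S2 w) (\<lambda>x. ennreal (g2 x w))"
    and g12: "(\<lambda>(x, w). g12 x w) \<in> borel_measurable borel" "\<And>x w. 0 < w \<Longrightarrow> 0 \<le> g12 x w"
      "\<And>w. 0 < w \<Longrightarrow> distributed N lborel (\<lambda>\<omega>. S1 w \<omega> + S2 w \<omega>) (\<lambda>x. ennreal (g12 x w))"
    using assms(14,15,16) by (auto simp: has_densities_def)
  note indep = independent_processes_indep_var[OF N \<open>independent_processes N S1 S2\<close>]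
  \<comment> \<open>The common value, up to \<open>\<sigma>\<^sup>2\<close>, of both formulas and of the autocorrelation of \<open>K\<close>.\<close>
  define c where "c x = 1 / Gamma \<beta> * (LBINT w:{0<..}. w powr (\<beta> - 1) * exp (- w * \<mu>\<^sup>2) * g12 x w)" for x
  interpret c: gamma_mixture g12 \<beta> "\<mu>\<^sup>2" c
    by unfold_locales
      (use assms(3,4) g12 density_integral_and_char(1)[OF g12(3) g12(2) N] in \<open>auto simp: c_def\<close>)
  let ?\<theta> = "\<lambda>\<tau>. \<bar>\<tau>\<bar> powr (2 * \<alpha>) + 2 * \<mu> * cos (pi * \<alpha> / 2) * \<bar>\<tau>\<bar> powr \<alpha>"
  have \<theta>: "0 \<le> ?\<theta> \<tau>" for \<tau>
  proof -
    have "\<alpha> * pi < 1 * pi" using \<open>\<alpha> < 1\<close> by (intro mult_strict_right_mono) auto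
    then have "0 \<le> cos (pi * \<alpha> / 2)"
      using \<open>0 < \<alpha>\<close> by (intro cos_ge_zero) (auto simp: mult.commute intro: order.trans[of _ 0])
    then show ?thesis using \<open>0 < \<mu>\<close> by simp
  qed
  have fourier_c: "(LINT x|lborel. iexp (\<tau> * x) * of_real (c x)) = of_real ((\<mu>\<^sup>2 + ?\<theta> \<tau>) powr - \<beta>)" for \<tau>
  proof (rule c.mixture_integral[OF _ _ \<theta>])
    show "(\<lambda>x. iexp (\<tau> * x)) \<in> borel_measurable borel" by measurable
    show "norm (iexp (\<tau> * x)) \<le> 1" for x by simp
    fix w :: real assume w: "0 < w"
    have "(LINT x|lborel. iexp (\<tau> * x) * of_real (g12 x w)) = char (distr N borel (\<lambda>\<omega>. S1 w \<omega> + S2 w \<omega>)) \<tau>"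
      by (rule density_integral_and_char(2)[OF g12(3)[OF w] g12(2)[OF w] N])
    also have "\<dots> = char (distr N borel (S1 w)) \<tau> * char (distr N borel (S2 w)) \<tau>"
      using w by (intro prob_space.char_distr_add[OF N] indep) simp
    also have "\<dots> = of_real (exp (- w * ?\<theta> \<tau>))"
      using w unfolding assms(12)[OF less_imp_le[OF w]] assms(13)[OF less_imp_le[OF w]]
      by (simp only: of_real_mult[symmetric] exp_add[symmetric]) (simp add: algebra_simps)
    finally show "(LINT x|lborel. iexp (\<tau> * x) * of_real (g12 x w)) = of_real (exp (- w * ?\<theta> \<tau>))" .
  qed
  have fourier_K: "(LINT x|lborel. iexp (\<tau> * x) * of_real (autocorrelation K x)) = of_real ((\<mu>\<^sup>2 + ?\<theta> \<tau>) powr - \<beta>)" for \<tau>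
    by (simp only: fourier_autocorrelation[OF K.mixture_integrable] K.fourier_norm)
  have auto_c: "AE x in lborel. autocorrelation K x = c x"
  proof (rule fourier_unique_nonneg)
    show "integrable lborel (autocorrelation K)" by (rule integrable_autocorrelation[OF K.mixture_integrable])
    show "0 \<le> autocorrelation K x" for x
      unfolding autocorrelation_def by (intro Bochner_Integration.integral_nonneg) (simp add: K.mixture_nonneg)
    have "complex_of_real (LBINT x. autocorrelation K x) = of_real ((\<mu>\<^sup>2 + ?\<theta> 0) powr - \<beta>)"
      using fourier_K[of 0] by simp
    then have "(LBINT x. autocorrelation K x) = (\<mu>\<^sup>2 + ?\<theta> 0) powr - \<beta>" by (simp only: of_real_eq_iff)
    then show "0 < (LBINT x. autocorrelation K x)" using \<open>0 < \<mu>\<close> \<theta>[of 0] by simp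
  qed (simp_all only: c.mixture_integrable c.mixture_nonneg fourier_K fourier_c)
  have conv: "AE x in lborel. c x = 1 / Gamma \<beta> * (LBINT w:{0<..}. w powr (\<beta> - 1) * exp (- w * \<mu>\<^sup>2) *
      (LBINT z. g1 (x - z) w * g2 z w))"
  proof -
    note [measurable (raw)] = borel_measurable_compose2[OF g1(1)] borel_measurable_compose2[OF g2(1)]
    \<comment> \<open>For each time the densities agree off a null set of positions; Fubini swaps the
      quantifiers, so that for almost every position they agree at almost every time.\<close>
    have "AE w in lborel. AE x in lborel. 0 < w \<longrightarrow> g12 x w = (LBINT z. g1 (x - z) w * g2 z w)"
    proof (rule AE_I2)
      fix w :: real
      show "AE x in lborel. 0 < w \<longrightarrow> g12 x w = (LBINT z. g1 (x - z) w * g2 z w)"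
      proof (cases "0 < w")
        case True
        then show ?thesis
          using sum_density_eq_convolution[OF N indep[of w] g1(3) g1(2) g2(3) g2(2) g12(3) g12(2)] by simp
      qed simp
    qed
    then have "AE x in lborel. AE w in lborel. 0 < w \<longrightarrow> g12 x w = (LBINT z. g1 (x - z) w * g2 z w)"
      by (subst (asm) lborel_pair.AE_commute) measurable
    then show ?thesis
    proof eventually_elim
      case (elim x)
      then have "(LBINT w:{0<..}. w powr (\<beta> - 1) * exp (- w * \<mu>\<^sup>2) * g12 x w)
          = (LBINT w:{0<..}. w powr (\<beta> - 1) * exp (- w * \<mu>\<^sup>2) * (LBINT z. g1 (x - z) w * g2 z w))"
        unfolding set_lebesgue_integral_def
        by (intro integral_cong_AE) (auto elim!: eventually_mono simp: indicator_def)
      then show ?case by (simp add: c_def)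
    qed
  qed
  have cov: "is_covariance_function M X (\<lambda>h. \<sigma>\<^sup>2 * autocorrelation K h)"
    unfolding \<open>X = _\<close> by (rule is_covariance_function_filtered_noise[OF assms(5) K.mixture_integrable])
  have E: "(\<integral>\<omega>. g12 h (W \<omega>) \<partial>P) = \<mu> powr (2 * \<beta>) * c h" for h
    unfolding c_def
    by (rule expectation_gamma_time[OF assms(18) _ assms(3,4)]) measurable
  show ?thesis
  proof (intro conjI exI[of _ "\<lambda>h. \<sigma>\<^sup>2 * autocorrelation K h"] allI impI cov)
    fix C assume "is_covariance_function M X C"
    then have "AE h in lborel. C h = \<sigma>\<^sup>2 * autocorrelation K h"
      by (rule is_covariance_function_unique[OF _ cov])
    with auto_c have C: "AE h in lborel. C h = \<sigma>\<^sup>2 * c h"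
      by eventually_elim simp
    show "AE h in lborel. C h = \<sigma>\<^sup>2 / Gamma \<beta> *
        (LBINT w:{0<..}. w powr (\<beta> - 1) * exp (- w * \<mu>\<^sup>2) * (LBINT z. g1 (h - z) w * g2 z w))"
      using C conv by eventually_elim simp
    show "AE h in lborel. C h = \<sigma>\<^sup>2 / \<mu> powr (2 * \<beta>) * (\<integral>\<omega>. g12 h (W \<omega>) \<partial>P)"
      using C by eventually_elim (use \<open>0 < \<mu>\<close> in \<open>simp add: E\<close>)
  qed
qed

end
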